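(* Let $Y$ be a transversally Hamiltonian doubly-resonant saddle-node, i.e. a transversally Hamiltonian germ of analytic vector field at $0\in\mathbb{C}^3$ which is conjugate, via a transversally symplectic diffeomorphism, to a vector field of the diagonal form $$x^2\frac{\partial}{\partial x}+\big(-\lambda y_1+F_1(x,\mathbf{y})\big)\frac{\partial}{\partial y_1}+\big(\lambda y_2+F_2(x,\mathbf{y})\big)\frac{\partial}{\partial y_2},$$ with $\lambda\in\mathbb{C}^*$ and $F_1,F_2$ analytic in $(\mathbb{C}^3,0)$ and of order at least $2$. Let $\hat\Phi$ be the unique formal normalizing map, i.e. the unique formal fibered transversally symplectic diffeomorphism, tangent to the identity, such that $$\hat\Phi_*(Y)=x^2\frac{\partial}{\partial x}+\big(-\lambda+a_1x-c(y_1y_2)\big)y_1\frac{\partial}{\partial y_1}+\big(\lambda+a_2x+c(y_1y_2)\big)y_2\frac{\partial}{\partial y_2}=:Y_{\mathrm{norm}},$$ where $c(v)\in v\,\mathbb{C}[[v]]$ and $a_1,a_2\in\mathbb{C}$ satisfy $a_1+a_2=1$. Then the associated sectorial normalizing maps $\Phi_+$ and $\Phi_-$ (the weak 1-sums of $\hat\Phi$ in the directions $\arg(i\lambda)$ and $\arg(-i\lambda)$, as described in the context) are also transversally symplectic.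
   Context: Coordinates on $\mathbb{C}^3$ are $(x,\mathbf{y})=(x,y_1,y_2)$; $(\mathbb{C}^n,0)$ denotes an arbitrarily small open neighborhood of the origin of $\mathbb{C}^n$. For a diffeomorphism $\Phi$, $\Phi_*(Y):=(\mathrm{D}\Phi\cdot Y)\circ\Phi^{-1}$. A diffeomorphism is fibered if it has the form $(x,\mathbf{y})\mapsto(x,\phi(x,\mathbf{y}))$. **Transverse structure.** Let $\omega:=\frac{\mathrm{d}y_1\wedge\mathrm{d}y_2}{x}$, and let $\langle\mathrm{d}x\rangle$ denote the ideal generated by $\mathrm{d}x$ in the algebra of differential forms (meromorphic near the origin with poles only on $\{x=0\}$; with the obvious analogues in the formal setting and on sectorial domains). A vector field $Y$ is transversally Hamiltonian (with respect to $\omega$ and $\mathrm{d}x$) if $\mathcal{L}_Y(\mathrm{d}x)\in\langle\mathrm{d}x\rangle$ and $\mathcal{L}_Y(\omega)\in\langle\mathrm{d}x\rangle$, where $\mathcal{L}_Y$ is the Lie derivative. A fibered diffeomorphism $\Phi$ (analytic, formal or sectorial) is transversally symplectic (with respect to $\omega$ and $\mathrm{d}x$) if $\Phi^*(\omega)\in\omega+\langle\mathrm{d}x\rangle$; equivalently, $\det(\mathrm{D}\Phi)=1$. **Origin of $\hat\Phi$.** It is a known theorem that if $Y$ is of the diagonal form displayed in the claim and is transversally Hamiltonian, then a formal map $\hat\Phi$ as in the claim exists and is unique. **Sectorial normalizing maps.** For $\epsilon\in\left]0,\frac{\pi}{2}\right[$ and $r>0$ small enough, let $S_\pm=\{x\in\mathbb{C}: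 0<|x|<r,\ |\arg(\pm x/(i\lambda))|<\frac{\pi}{2}+\epsilon\}$. A vector field $Y$ of the diagonal form which is transversally Hamiltonian has residue $1$ (the residue is $(\operatorname{Tr}\mathbf{A}(x)/x)_{|x=0}$, with $\mathbf{A}(x)$ the matrix of the linear part in $\mathbf{y}$, at $\mathbf{y}=\mathbf{0}$, of the $(\partial_{y_1},\partial_{y_2})$-components of $Y$), and its restriction to $\{x=0\}$ is analytically orbitally linearizable (analytically conjugate to a non-vanishing function times a linear diagonal vector field). It is known that then $\hat\Phi$ is weakly 1-summable in every direction except $\arg(\pm\lambda)$, and that there are unique germs $\Phi_\pm$ of analytic sectorial fibered diffeomorphisms, tangent to the identity, in $S_\pm\times(\mathbb{C}^2,0)$, which admit $\hat\Phi$ as weak Gevrey-1 asymptotic expansion and satisfy $(\Phi_\pm)_*(Y)=Y_{\mathrm{norm}}$. They are called the sectorial normalizing maps of $Y$, and are the weak 1-sums of $\hat\Phi$ in the directions $\arg(\pm i\lambda)$. **Conventions.** A sectorial fibered diffeomorphism on $\mathcal{S}=S\times(\mathbb{C}^2,0)$ is a holomorphic fibered diffeomorphism from $\mathcal S$ onto its image; it is tangent to the identity if $\Phi(x,\mathbf{y})-(x,\mathbf{y})=O(\|(x,\mathbf{y})\|^2)$ as $(x,\mathbf{y})\to(0,\mathbf{0})$ in $\mathcal{S}$. A function $f=\sum_{\mathbf{j}}F_{\mathbf{j}}(x)\mathbf{y}^{\mathbf{j}}$, analytic and bounded on the product of a sector $S$ and a polydisc, admits $\hat f=\sum_{\mathbf{j}}\hat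 F_{\mathbf{j}}(x)\mathbf{y}^{\mathbf{j}}$ as weak Gevrey-1 asymptotic expansion if, for each $\mathbf{j}$, writing $\hat F_{\mathbf{j}}=\sum_kF_{\mathbf{j},k}x^k$, for every closed subsector $S'\subset S$ there are $A,C>0$ with $|F_{\mathbf{j}}(x)-\sum_{k<N}F_{\mathbf{j},k}x^k|\le AC^NN!\,|x|^N$ for all $N\in\mathbb{N}$, $x\in S'$. The series $\hat f$ is weakly 1-summable in the direction $\theta$ if each $\hat F_{\mathbf{j}}$ is 1-summable in the direction $\theta$ (i.e. is the Gevrey-1 asymptotic expansion of a function $F_{\mathbf{j},\theta}$ analytic on a sector of opening greater than $\pi$ bisected by $\theta$) and $\sum_{\mathbf{j}}F_{\mathbf{j},\theta}(x)\mathbf{y}^{\mathbf{j}}$, the weak 1-sum of $\hat f$, is holomorphic on the product of such a sector with a polydisc. For maps these notions are meant componentwise. *)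

theory Defs
  imports
    "HOL-Analysis.Analysis"
    "HOL-Library.Landau_Symbols"
    "HOL-Computational_Algebra.Fraction_Field"
begin

unbundle no fps_syntax

text \<open>
  Points of \<open>\<complex>\<^sup>3\<close> are vectors \<open>p\<close> with \<open>x = p $ 1\<close>, \<open>y\<^sub>1 = p $ 2\<close>, \<open>y\<^sub>2 = p $ 3\<close>.
  A germ is given by a representative together with a set on which it is considered;
  its values outside that set are irrelevant.
\<close>

section \<open>Holomorphic functions and maps\<close>

definition hol_on :: "(complex^'n \<Rightarrow> complex) \<Rightarrow> (complex^'n) set \<Rightarrow> bool" where
  "hol_on f D \<longleftrightarrow>
     (\<forall>p\<in>D. \<exists>a :: complex^'n. (f has_derivative (\<lambda>h. \<Sum>i\<in>UNIV. a $ i * h $ i)) (at p))"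

definition hol_map_on :: "(complex^'n \<Rightarrow> complex^'m) \<Rightarrow> (complex^'n) set \<Rightarrow> bool" where
  "hol_map_on f D \<longleftrightarrow> (\<forall>m. hol_on (\<lambda>p. f p $ m) D)"

definition biholomorphic_on :: "(complex^'n \<Rightarrow> complex^'n) \<Rightarrow> (complex^'n) set \<Rightarrow> bool" where
  "biholomorphic_on f D \<longleftrightarrow>
     hol_map_on f D \<and> inj_on f D \<and> hol_map_on (inv_into D f) (f ` D)"

definition partial :: "'n \<Rightarrow> (complex^'n \<Rightarrow> complex) \<Rightarrow> complex^'n \<Rightarrow> complex" where
  "partial i f p = deriv (\<lambda>t. f (p + axis i t)) 0"

definition cjacobian :: "(complex^'n \<Rightarrow> complex^'m) \<Rightarrow> complex^'n \<Rightarrow> complex^'n^'m" where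
  "cjacobian f p = (\<chi> i j. partial j (\<lambda>q. f q $ i) p)"

text \<open>The push-forward \<open>(D\<Phi> \<cdot> Y) \<circ> \<Phi>\<inverse>\<close>, a vector field on \<open>\<Phi> ` D\<close>.\<close>

definition pushforward ::
  "(complex^'n) set \<Rightarrow> (complex^'n \<Rightarrow> complex^'n) \<Rightarrow> (complex^'n \<Rightarrow> complex^'n)
     \<Rightarrow> complex^'n \<Rightarrow> complex^'n" where
  "pushforward D \<Phi> Y q = (let p = inv_into D \<Phi> q in cjacobian \<Phi> p *v Y p)"

definition fibered_on :: "(complex^3) set \<Rightarrow> (complex^3 \<Rightarrow> complex^3) \<Rightarrow> bool" where
  "fibered_on D \<Phi> \<longleftrightarrow> (\<forall>p\<in>D. \<Phi> p $ 1 = p $ 1)"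

definition tangent_id_on :: "(complex^3) set \<Rightarrow> (complex^3 \<Rightarrow> complex^3) \<Rightarrow> bool" where
  "tangent_id_on D \<Phi> \<longleftrightarrow>
     (\<lambda>p. norm (\<Phi> p - p)) \<in> O[at 0 within D](\<lambda>p. norm p ^ 2)"

section \<open>Differential forms and the transverse structure\<close>

text \<open>
  At each point, a 1-form is the vector of its coefficients in the basis
  \<open>dx, dy\<^sub>1, dy\<^sub>2\<close>, and a 2-form \<open>\<eta>\<close> is the antisymmetric matrix of its values
  \<open>\<eta>(\<partial>\<^sub>i, \<partial>\<^sub>j)\<close> on the coordinate vector fields.
\<close>

definition wedge :: "'a::comm_ring_1^3 \<Rightarrow> 'a^3 \<Rightarrow> 'a^3^3" where
  "wedge \<alpha> \<beta> = (\<chi> i j. \<alpha> $ i * \<beta> $ j - \<alpha> $ j * \<beta> $ i)"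

abbreviation dx :: "'a::comm_ring_1^3" where "dx \<equiv> axis 1 1"
abbreviation dy1 :: "'a::comm_ring_1^3" where "dy1 \<equiv> axis 2 1"
abbreviation dy2 :: "'a::comm_ring_1^3" where "dy2 \<equiv> axis 3 1"

definition omega :: "complex^3 \<Rightarrow> complex^3^3" where
  "omega p = (\<chi> i j. wedge dy1 dy2 $ i $ j / p $ 1)"

definition pullback2 ::
  "(complex^3 \<Rightarrow> complex^3) \<Rightarrow> (complex^3 \<Rightarrow> complex^3^3) \<Rightarrow> complex^3 \<Rightarrow> complex^3^3" where
  "pullback2 \<Phi> \<eta> p = transpose (cjacobian \<Phi> p) ** \<eta> (\<Phi> p) ** cjacobian \<Phi> p"

text \<open>Lie derivatives, by the coordinate formulas
  \<open>(\<L>\<^sub>Y \<alpha>)\<^sub>i = \<Sum>\<^sub>k Y\<^sub>k \<partial>\<^sub>k\<alpha>\<^sub>i + \<alpha>\<^sub>k \<partial>\<^sub>iY\<^sub>k\<close> and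
  \<open>(\<L>\<^sub>Y \<eta>)\<^sub>i\<^sub>j = \<Sum>\<^sub>k Y\<^sub>k \<partial>\<^sub>k\<eta>\<^sub>i\<^sub>j + \<eta>\<^sub>k\<^sub>j \<partial>\<^sub>iY\<^sub>k + \<eta>\<^sub>i\<^sub>k \<partial>\<^sub>jY\<^sub>k\<close>.\<close>

definition lie1 ::
  "(complex^3 \<Rightarrow> complex^3) \<Rightarrow> (complex^3 \<Rightarrow> complex^3) \<Rightarrow> complex^3 \<Rightarrow> complex^3" where
  "lie1 Y \<alpha> p =
     (\<chi> i. \<Sum>k\<in>UNIV. Y p $ k * partial k (\<lambda>q. \<alpha> q $ i) p
                     + \<alpha> p $ k * partial i (\<lambda>q. Y q $ k) p)"

definition lie2 ::
  "(complex^3 \<Rightarrow> complex^3) \<Rightarrow> (complex^3 \<Rightarrow> complex^3^3) \<Rightarrow> complex^3 \<Rightarrow> complex^3^3" where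
  "lie2 Y \<eta> p =
     (\<chi> i j. \<Sum>k\<in>UNIV. Y p $ k * partial k (\<lambda>q. \<eta> q $ i $ j) p
                       + \<eta> p $ k $ j * partial i (\<lambda>q. Y q $ k) p
                       + \<eta> p $ i $ k * partial j (\<lambda>q. Y q $ k) p)"

text \<open>Meromorphic functions on \<open>D\<close> with poles only on \<open>{x = 0}\<close>; if \<open>D\<close> does not meet
  \<open>{x = 0}\<close>, as for sectorial domains, these are the holomorphic functions on \<open>D\<close>.\<close>

definition mero_on :: "(complex^3 \<Rightarrow> complex) \<Rightarrow> (complex^3) set \<Rightarrow> bool" where
  "mero_on g D \<longleftrightarrow> (\<exists>N h. hol_on h D \<and> (\<forall>p\<in>D. p $ 1 \<noteq> 0 \<longrightarrow> g p = h p / (p $ 1) ^ N))"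

text \<open>The parts of degree 1 and 2 of the ideal \<open>\<langle>dx\<rangle>\<close> of the algebra of forms on \<open>D\<close>.\<close>

definition in_ideal_dx1 :: "(complex^3 \<Rightarrow> complex^3) \<Rightarrow> (complex^3) set \<Rightarrow> bool" where
  "in_ideal_dx1 \<theta> D \<longleftrightarrow>
     (\<exists>g. mero_on g D \<and> (\<forall>p\<in>D. p $ 1 \<noteq> 0 \<longrightarrow> \<theta> p = g p *s dx))"

definition in_ideal_dx2 :: "(complex^3 \<Rightarrow> complex^3^3) \<Rightarrow> (complex^3) set \<Rightarrow> bool" where
  "in_ideal_dx2 \<eta> D \<longleftrightarrow>
     (\<exists>\<alpha>. (\<forall>m. mero_on (\<lambda>p. \<alpha> p $ m) D) \<and> (\<forall>p\<in>D. p $ 1 \<noteq> 0 \<longrightarrow> \<eta> p = wedge dx (\<alpha> p)))"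

definition transv_hamiltonian_on :: "(complex^3) set \<Rightarrow> (complex^3 \<Rightarrow> complex^3) \<Rightarrow> bool" where
  "transv_hamiltonian_on D Y \<longleftrightarrow>
     in_ideal_dx1 (lie1 Y (\<lambda>_. dx)) D \<and> in_ideal_dx2 (lie2 Y omega) D"

definition transv_symplectic_on :: "(complex^3) set \<Rightarrow> (complex^3 \<Rightarrow> complex^3) \<Rightarrow> bool" where
  "transv_symplectic_on D \<Phi> \<longleftrightarrow>
     in_ideal_dx2 (\<lambda>p. pullback2 \<Phi> omega p - omega p) D"

section \<open>Formal power series in three variables\<close>

text \<open>
  \<open>\<complex>[[x]][[y\<^sub>1]][[y\<^sub>2]]\<close>; thus \<open>fps_nth (fps_nth f j) i\<close> is the coefficient
  in \<open>\<complex>[[x]]\<close> of \<open>y\<^sub>1\<^sup>i y\<^sub>2\<^sup>j\<close>.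
\<close>

type_synonym fser = "complex fps fps fps"

text \<open>The coefficient of \<open>x\<^sup>k y\<^sub>1\<^sup>i y\<^sub>2\<^sup>j\<close>.\<close>

definition fcoeff :: "fser \<Rightarrow> nat \<Rightarrow> nat \<Rightarrow> nat \<Rightarrow> complex" where
  "fcoeff f k i j = fps_nth (fps_nth (fps_nth f j) i) k"

definition Abs_fser :: "(nat \<Rightarrow> nat \<Rightarrow> nat \<Rightarrow> complex) \<Rightarrow> fser" where
  "Abs_fser F = Abs_fps (\<lambda>j. Abs_fps (\<lambda>i. Abs_fps (\<lambda>k. F k i j)))"

definition fC :: "complex \<Rightarrow> fser" where "fC a = fps_const (fps_const (fps_const a))"
definition fX :: fser where "fX = fps_const (fps_const fps_X)"
definition fY1 :: fser where "fY1 = fps_const fps_X"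
definition fY2 :: fser where "fY2 = fps_X"

definition order_ge :: "nat \<Rightarrow> fser \<Rightarrow> bool" where
  "order_ge n f \<longleftrightarrow> (\<forall>k i j. k + i + j < n \<longrightarrow> fcoeff f k i j = 0)"

definition taylor :: "(complex^3 \<Rightarrow> complex) \<Rightarrow> fser" where
  "taylor f = Abs_fser (\<lambda>k i j.
     (partial 1 ^^ k) ((partial 2 ^^ i) ((partial 3 ^^ j) f)) 0 / (fact k * fact i * fact j))"

text \<open>The differential of a formal series, with components \<open>\<partial>\<^sub>x f, \<partial>\<^sub>y\<^sub>1 f, \<partial>\<^sub>y\<^sub>2 f\<close>.\<close>

definition fdiff :: "fser \<Rightarrow> fser^3" where
  "fdiff f = vector
     [Abs_fps (\<lambda>j. Abs_fps (\<lambda>i. fps_deriv (fps_nth (fps_nth f j) i))),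
      Abs_fps (\<lambda>j. fps_deriv (fps_nth f j)),
      fps_deriv f]"

text \<open>Substitution \<open>f(\<Phi>\<^sub>1, \<Phi>\<^sub>2, \<Phi>\<^sub>3)\<close>, for \<open>\<Phi>\<close> without constant term: the monomials of \<open>f\<close>
  of degree larger than \<open>k + i + j\<close> do not contribute to the coefficient of
  \<open>x\<^sup>k y\<^sub>1\<^sup>i y\<^sub>2\<^sup>j\<close>.\<close>

definition fcompose :: "fser \<Rightarrow> fser^3 \<Rightarrow> fser" where
  "fcompose f \<Phi> = Abs_fser (\<lambda>k i j.
     \<Sum>(k', i', j') \<in> {(k', i', j'). k' + i' + j' \<le> k + i + j}.
        fcoeff f k' i' j' * fcoeff ((\<Phi> $ 1) ^ k' * (\<Phi> $ 2) ^ i' * (\<Phi> $ 3) ^ j') k i j)"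

definition fcompose_map :: "fser^3 \<Rightarrow> fser^3 \<Rightarrow> fser^3" where
  "fcompose_map \<Psi> \<Phi> = (\<chi> m. fcompose (\<Psi> $ m) \<Phi>)"

definition fid :: "fser^3" where "fid = vector [fX, fY1, fY2]"

definition formal_inverse :: "fser^3 \<Rightarrow> fser^3 \<Rightarrow> bool" where
  "formal_inverse \<Phi> \<Psi> \<longleftrightarrow> (\<forall>m. order_ge 1 (\<Phi> $ m)) \<and> (\<forall>m. order_ge 1 (\<Psi> $ m))
     \<and> fcompose_map \<Phi> \<Psi> = fid \<and> fcompose_map \<Psi> \<Phi> = fid"

definition formal_diffeo :: "fser^3 \<Rightarrow> bool" where
  "formal_diffeo \<Phi> \<longleftrightarrow> (\<exists>\<Psi>. formal_inverse \<Phi> \<Psi>)"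

definition formal_fibered :: "fser^3 \<Rightarrow> bool" where
  "formal_fibered \<Phi> \<longleftrightarrow> \<Phi> $ 1 = fX"

definition formal_tangent_id :: "fser^3 \<Rightarrow> bool" where
  "formal_tangent_id \<Phi> \<longleftrightarrow> (\<forall>m. order_ge 2 (\<Phi> $ m - fid $ m))"

definition formal_pushforward :: "fser^3 \<Rightarrow> fser^3 \<Rightarrow> fser^3" where
  "formal_pushforward \<Phi> Y =
     fcompose_map (\<chi> m. \<Sum>n\<in>UNIV. fdiff (\<Phi> $ m) $ n * Y $ n) (THE \<Psi>. formal_inverse \<Phi> \<Psi>)"

text \<open>
  Formal forms with poles on \<open>{x = 0}\<close> have coefficients in \<open>\<complex>[[x, y\<^sub>1, y\<^sub>2]][1/x]\<close>, here a
  subring of the fraction field. The pull-back of \<open>\<omega> = dy\<^sub>1 \<and> dy\<^sub>2 / x\<close> by \<open>\<Phi>\<close> is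
  \<open>d\<Phi>\<^sub>2 \<and> d\<Phi>\<^sub>3 / \<Phi>\<^sub>1\<close>.
\<close>

definition formal_omega :: "fser fract^3^3" where
  "formal_omega = (\<chi> i j. Fract (wedge dy1 dy2 $ i $ j) fX)"

definition formal_pullback_omega :: "fser^3 \<Rightarrow> fser fract^3^3" where
  "formal_pullback_omega \<Phi> =
     (\<chi> i j. Fract (wedge (fdiff (\<Phi> $ 2)) (fdiff (\<Phi> $ 3)) $ i $ j) (\<Phi> $ 1))"

definition formal_in_ideal_dx2 :: "fser fract^3^3 \<Rightarrow> bool" where
  "formal_in_ideal_dx2 \<eta> \<longleftrightarrow>
     (\<exists>(\<beta> :: fser^3) N. \<eta> = wedge dx (\<chi> m. Fract (\<beta> $ m) (fX ^ N)))"

definition formal_transv_symplectic :: "fser^3 \<Rightarrow> bool" where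
  "formal_transv_symplectic \<Phi> \<longleftrightarrow>
     formal_in_ideal_dx2 (formal_pullback_omega \<Phi> - formal_omega)"

section \<open>Sectors and weak Gevrey-1 asymptotic expansions\<close>

text \<open>The sector bisected by the direction of \<open>d \<noteq> 0\<close>, of half-opening \<open>\<beta> \<le> \<pi>\<close>.\<close>

definition sector :: "complex \<Rightarrow> real \<Rightarrow> real \<Rightarrow> complex set" where
  "sector d \<beta> r = {x. 0 < cmod x \<and> cmod x < r \<and> \<bar>Arg (x / d)\<bar> < \<beta>}"

definition closed_sector :: "complex \<Rightarrow> real \<Rightarrow> real \<Rightarrow> real \<Rightarrow> complex set" where
  "closed_sector d a b s =
     {x. 0 < cmod x \<and> cmod x \<le> s \<and> a \<le> Arg (x / d) \<and> Arg (x / d) \<le> b}"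

definition sectorial_domain :: "complex \<Rightarrow> real \<Rightarrow> real \<Rightarrow> real \<Rightarrow> (complex^3) set" where
  "sectorial_domain d \<beta> r \<rho> =
     {p. p $ 1 \<in> sector d \<beta> r \<and> cmod (p $ 2) < \<rho> \<and> cmod (p $ 3) < \<rho>}"

text \<open>The coefficient \<open>F\<^sub>i\<^sub>j(x)\<close> in the expansion \<open>f(x, y) = \<Sum> F\<^sub>i\<^sub>j(x) y\<^sub>1\<^sup>i y\<^sub>2\<^sup>j\<close>.\<close>

definition ycoeff :: "(complex^3 \<Rightarrow> complex) \<Rightarrow> nat \<Rightarrow> nat \<Rightarrow> complex \<Rightarrow> complex" where
  "ycoeff f i j x = (partial 2 ^^ i) ((partial 3 ^^ j) f) (vector [x, 0, 0]) / (fact i * fact j)"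

definition weak_gevrey1_expansion ::
  "complex \<Rightarrow> real \<Rightarrow> real \<Rightarrow> real \<Rightarrow> (complex^3 \<Rightarrow> complex) \<Rightarrow> fser \<Rightarrow> bool" where
  "weak_gevrey1_expansion d \<beta> r \<rho> f F \<longleftrightarrow>
     hol_on f (sectorial_domain d \<beta> r \<rho>) \<and>
     bounded (f ` sectorial_domain d \<beta> r \<rho>) \<and>
     (\<forall>i j a b s. - \<beta> < a \<and> a \<le> b \<and> b < \<beta> \<and> 0 < s \<and> s < r \<longrightarrow>
        (\<exists>A>0. \<exists>C>0. \<forall>N. \<forall>x\<in>closed_sector d a b s.
           cmod (ycoeff f i j x - (\<Sum>k<N. fcoeff F k i j * x ^ k))
             \<le> A * C ^ N * fact N * cmod x ^ N))"

section \<open>Doubly-resonant saddle-nodes and their normalizing maps\<close>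

text \<open>
  \<open>Y\<close>, holomorphic on the neighbourhood \<open>U\<close> of the origin, represents a transversally
  Hamiltonian germ that some transversally symplectic germ of diffeomorphism \<open>\<Psi>\<close>
  conjugates to the diagonal form.
\<close>

definition transv_hamiltonian_doubly_resonant_saddle_node ::
  "complex \<Rightarrow> (complex^3) set \<Rightarrow> (complex^3 \<Rightarrow> complex^3) \<Rightarrow> bool" where
  "transv_hamiltonian_doubly_resonant_saddle_node lam U Y \<longleftrightarrow>
     lam \<noteq> 0 \<and> open U \<and> 0 \<in> U \<and> hol_map_on Y U \<and>
     (\<exists>W. open W \<and> 0 \<in> W \<and> W \<subseteq> U \<and> transv_hamiltonian_on W Y) \<and>
     (\<exists>V \<Psi> F1 F2.
        open V \<and> 0 \<in> V \<and> V \<subseteq> U \<and> \<Psi> 0 = 0 \<and>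
        biholomorphic_on \<Psi> V \<and> fibered_on V \<Psi> \<and> transv_symplectic_on V \<Psi> \<and>
        hol_on F1 (\<Psi> ` V) \<and> order_ge 2 (taylor F1) \<and>
        hol_on F2 (\<Psi> ` V) \<and> order_ge 2 (taylor F2) \<and>
        (\<forall>q\<in>\<Psi> ` V. pushforward V \<Psi> Y q =
           vector [(q $ 1)\<^sup>2, - lam * q $ 2 + F1 q, lam * q $ 3 + F2 q]))"

text \<open>\<open>c(y\<^sub>1y\<^sub>2)\<close> as a series in \<open>y\<^sub>2\<close>, in which \<open>y\<^sub>1y\<^sub>2\<close> has no constant term.\<close>

definition formal_subst_y1y2 :: "complex fps \<Rightarrow> fser" where
  "formal_subst_y1y2 c =
     fps_compose (Abs_fps (\<lambda>n. fps_const (fps_const (fps_nth c n)))) (fY1 * fY2)"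

definition formal_Ynorm :: "complex \<Rightarrow> complex \<Rightarrow> complex \<Rightarrow> complex fps \<Rightarrow> fser^3" where
  "formal_Ynorm lam a1 a2 c = vector
     [fX\<^sup>2,
      (- fC lam + fC a1 * fX - formal_subst_y1y2 c) * fY1,
      (fC lam + fC a2 * fX + formal_subst_y1y2 c) * fY2]"

text \<open>Meaningful where \<open>y\<^sub>1y\<^sub>2\<close> lies in the disc of convergence of \<open>c\<close>.\<close>

definition Ynorm ::
  "complex \<Rightarrow> complex \<Rightarrow> complex \<Rightarrow> complex fps \<Rightarrow> complex^3 \<Rightarrow> complex^3" where
  "Ynorm lam a1 a2 c q = vector
     [(q $ 1)\<^sup>2,
      (- lam + a1 * q $ 1 - eval_fps c (q $ 2 * q $ 3)) * q $ 2,
      (lam + a2 * q $ 1 + eval_fps c (q $ 2 * q $ 3)) * q $ 3]"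

definition formal_normalizing_map ::
  "(complex^3 \<Rightarrow> complex^3) \<Rightarrow> complex \<Rightarrow> complex \<Rightarrow> complex \<Rightarrow> complex fps \<Rightarrow> fser^3 \<Rightarrow> bool"
  where
  "formal_normalizing_map Y lam a1 a2 c \<Phi>h \<longleftrightarrow>
     formal_diffeo \<Phi>h \<and> formal_fibered \<Phi>h \<and> formal_tangent_id \<Phi>h \<and>
     formal_transv_symplectic \<Phi>h \<and>
     formal_pushforward \<Phi>h (\<chi> m. taylor (\<lambda>p. Y p $ m)) = formal_Ynorm lam a1 a2 c"

text \<open>
  \<open>\<Phi>\<close> on the product of the sector with direction \<open>d\<close> and half-opening \<open>\<pi>/2 + \<epsilon>\<close>
  with a polydisc. The opening exceeds \<open>\<pi>\<close>, so that the Gevrey-1 condition says that \<open>\<Phi>\<close> is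
  the weak 1-sum of \<open>\<Phi>h\<close> in the direction \<open>arg d\<close>. That the image lies in the domain of
  convergence of \<open>c\<close> is part of the meaning of \<open>\<Phi>\<^sub>*(Y) = Y\<^sub>n\<^sub>o\<^sub>r\<^sub>m\<close>.
\<close>

definition sectorial_normalizing_map ::
  "(complex^3) set \<Rightarrow> (complex^3 \<Rightarrow> complex^3) \<Rightarrow>
   complex \<Rightarrow> complex \<Rightarrow> complex \<Rightarrow> complex fps \<Rightarrow> fser^3 \<Rightarrow>
   complex \<Rightarrow> real \<Rightarrow> real \<Rightarrow> real \<Rightarrow> (complex^3 \<Rightarrow> complex^3) \<Rightarrow> bool" where
  "sectorial_normalizing_map U Y lam a1 a2 c \<Phi>h d \<epsilon> r \<rho> \<Phi> \<longleftrightarrow>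
     (let \<beta> = pi / 2 + \<epsilon>; D = sectorial_domain d \<beta> r \<rho> in
        D \<subseteq> U \<and> biholomorphic_on \<Phi> D \<and> fibered_on D \<Phi> \<and> tangent_id_on D \<Phi> \<and>
        (\<forall>m. weak_gevrey1_expansion d \<beta> r \<rho> (\<lambda>p. \<Phi> p $ m) (\<Phi>h $ m)) \<and>
        (\<forall>q\<in>\<Phi> ` D. ereal (cmod (q $ 2 * q $ 3)) < fps_conv_radius c \<and>
           pushforward D \<Phi> Y q = Ynorm lam a1 a2 c q))"

end

theory Submission
  imports Defs "HOL-Complex_Analysis.Conformal_Mappings"
begin

unbundle no fps_syntax

text \<open>
  The transverse Jacobian \<open>J = det (\<partial>\<Phi>\<^sub>i / \<partial>y\<^sub>j)\<close> of a sectorial normalizing map \<open>\<Phi>\<close> is a first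
  integral of \<open>Y\<close>: the transverse divergences of \<open>Y\<close> and of its image \<open>Y\<^sub>n\<^sub>o\<^sub>r\<^sub>m\<close> are both
  equal to \<open>x\<close>, the first because \<open>Y\<close> is transversally Hamiltonian, the second because
  \<open>a\<^sub>1 + a\<^sub>2 = 1\<close>. As \<open>\<Phi>\<close> is tangent to the identity, Cauchy's estimate gives
  \<open>J \<rightarrow> 1\<close> at the origin.

  The vector field \<open>Y\<^sub>n\<^sub>o\<^sub>r\<^sub>m\<close> is integrable by quadrature, since \<open>y\<^sub>1y\<^sub>2/x\<close> is a
  first integral. Along a real path on which \<open>x\<close> tends to \<open>0\<close> asymptotically in the
  bisecting direction \<open>\<plusminus>i\<lambda>\<close>, the factor \<open>exp (\<lambda>/x)\<close> has modulus a power of \<open>|x|\<close>,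
  and this power can be chosen so that \<open>y\<^sub>1\<close> and \<open>y\<^sub>2\<close> both decay. The image of
  \<open>\<Phi>\<close> contains these trajectories (Brouwer), so \<open>J\<close>, constant on their preimages,
  is equal to \<open>1\<close> there. They meet a set of uniqueness for holomorphic functions, hence
  \<open>J = 1\<close> everywhere, which says that \<open>\<Phi>\<close> is transversally symplectic.
\<close>

section \<open>Partial derivatives of holomorphic functions of several variables\<close>

lemma norm_axis_complex: "norm (axis i t :: complex^'n) = cmod t"
proof -
  have "(\<Sum>j\<in>UNIV. (cmod ((axis i t :: complex^'n) $ j))\<^sup>2) = (\<Sum>j\<in>UNIV. if j = i then (cmod t)\<^sup>2 else 0)"
    by (rule sum.cong) (auto simp: axis_def)
  then show ?thesis by (simp add: norm_vec_def L2_set_def)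
qed

lemma bounded_linear_axis: "bounded_linear (axis i :: complex \<Rightarrow> complex^'n)"
  by (rule bounded_linear_intro[of _ 1])
     (simp_all add: norm_axis_complex, auto simp: axis_def vec_eq_iff)

lemma axis_zero: "axis i (0 :: complex) = 0"
  by simp

lemmas continuous_on_axis [continuous_intros] = bounded_linear.continuous_on[OF bounded_linear_axis]

lemma sum_mult_axis: "(\<Sum>j\<in>UNIV. a $ j * (axis i t :: complex^'n) $ j) = a $ i * t"
proof -
  have "(\<Sum>j\<in>UNIV. a $ j * (axis i t :: complex^'n) $ j) = (\<Sum>j\<in>UNIV. if j = i then a $ i * t else 0)"
    by (rule sum.cong) (auto simp: axis_def)
  then show ?thesis by simp
qed

lemma has_field_derivative_line:
  fixes p :: "complex^'n"
  assumes "(f has_derivative (\<lambda>h. \<Sum>j\<in>UNIV. a $ j * h $ j)) (at (p + axis i t))"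
  shows "((\<lambda>s. f (p + axis i s)) has_field_derivative a $ i) (at t)"
proof -
  have "((\<lambda>s. p + axis i s) has_derivative axis i) (at t)"
    using bounded_linear_imp_has_derivative[OF bounded_linear_axis[where 'n='n and i=i]]
    by (auto intro!: derivative_eq_intros)
  from diff_chain_at[OF this assms]
  show ?thesis
    by (simp add: has_field_derivative_def o_def sum_mult_axis mult.commute[of "a $ i"] mult_commute_abs)
qed

lemma partial_eqI:
  assumes "((\<lambda>t. f (p + axis i t)) has_field_derivative d) (at 0)"
  shows "partial i f p = d"
  unfolding partial_def by (rule DERIV_imp_deriv[OF assms])

text \<open>The coefficients hidden in the existential of \<open>hol_on\<close> are forced:
  restricting the differential to each coordinate axis identifies them with the partial
  derivatives.\<close>

lemma hol_on_has_derivative: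
  assumes "hol_on f D" "p \<in> D"
  shows "(f has_derivative (\<lambda>h. \<Sum>j\<in>UNIV. partial j f p * h $ j)) (at p)"
proof -
  from assms obtain a where a: "(f has_derivative (\<lambda>h. \<Sum>j\<in>UNIV. a $ j * h $ j)) (at p)"
    unfolding hol_on_def by blast
  have "partial j f p = a $ j" for j
    using has_field_derivative_line[of f a p j 0] a by (intro partial_eqI) (simp add: axis_zero)
  with a show ?thesis by simp
qed

lemma hol_on_line:
  assumes "hol_on f D" "p + axis i t \<in> D"
  shows "((\<lambda>s. f (p + axis i s)) has_field_derivative partial i f (p + axis i t)) (at t)"
  using has_field_derivative_line[of f "\<chi> j. partial j f (p + axis i t)"] hol_on_has_derivative[OF assms]
  by simp

lemma hol_on_partial_derivative:
  assumes "hol_on f D" "p \<in> D"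
  shows "((\<lambda>t. f (p + axis i t)) has_field_derivative partial i f p) (at 0)"
  using hol_on_line[OF assms(1), of p i 0] assms(2) by (simp add: axis_zero)

lemma hol_on_continuous: "hol_on f D \<Longrightarrow> continuous_on D f"
  by (meson continuous_at_imp_continuous_on has_derivative_continuous hol_on_has_derivative)

section \<open>Cauchy's formula and regularity of partial derivatives\<close>

definition circ :: "real \<Rightarrow> real \<Rightarrow> complex" where
  "circ s \<theta> = of_real s * exp (2 * of_real pi * \<i> * of_real \<theta>)"

lemma norm_circ: "0 < s \<Longrightarrow> cmod (circ s \<theta>) = s"
  by (simp add: circ_def norm_mult)

text \<open>The velocity of the circle cancels the constant of Cauchy's formula and one power of the
  squared denominator. What remains is an integral over a fixed real interval, ready for
  differentiation under the integral sign.\<close>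

lemma Cauchy_derivative_circle:
  assumes "0 < s" "g holomorphic_on S" "cball 0 s \<subseteq> S"
  shows "((\<lambda>\<theta>. g (circ s \<theta>) *
            (1 / circ s \<theta>)) has_integral deriv g 0) {0..1}"
proof -
  have "((\<lambda>u. g u / (u - 0) ^ Suc 1) has_contour_integral ((2 * pi * \<i>) / (fact 1) * (deriv ^^ 1) g 0))
           (circlepath 0 s)"
    using assms holomorphic_on_subset[OF assms(2), of "ball 0 s"] holomorphic_on_subset[OF assms(2), of "cball 0 s"]
    by (intro Cauchy_has_contour_integral_higher_derivative_circlepath)
       (auto intro!: holomorphic_on_imp_continuous_on)
  then have "((\<lambda>x. g (circlepath 0 s x) / (circlepath 0 s x)\<^sup>2 * vector_derivative (circlepath 0 s) (at x))
       has_integral (2 * pi * \<i>) * deriv g 0) {0..1}"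
    by (simp add: has_contour_integral power2_eq_square)
  from has_integral_mult_right[OF this, of "1 / (2 * pi * \<i>)"]
  have "((\<lambda>x. 1 / (2 * pi * \<i>) * (g (circlepath 0 s x) / (circlepath 0 s x)\<^sup>2 * vector_derivative (circlepath 0 s) (at x)))
       has_integral deriv g 0) {0..1}"
    by simp
  then show ?thesis
    by (rule has_integral_eq[rotated])
       (use assms(1) in \<open>simp only: vector_derivative_circlepath, simp add: circlepath circ_def power2_eq_square\<close>)
qed

lemma partial_circle_integral:
  fixes f :: "complex^'n \<Rightarrow> complex"
  assumes f: "\<And>t. cmod t < R \<Longrightarrow> (\<lambda>t. f (p + axis i t)) field_differentiable at t" and s: "0 < s" "s < R"
  shows "((\<lambda>\<theta>. f (p + axis i (circ s \<theta>)) *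
            (1 / circ s \<theta>)) has_integral partial i f p) {0..1}"
proof -
  have "(\<lambda>t. f (p + axis i t)) holomorphic_on ball 0 R"
    using f by (auto simp: holomorphic_on_def intro: field_differentiable_at_within)
  then show ?thesis
    unfolding partial_def using s by (intro Cauchy_derivative_circle[of s _ "ball 0 R"]) auto
qed

text \<open>The factor 2 leaves room around the circle of radius \<open>s\<close>, and one
  \<open>s\<close> serves all base points near \<open>p\<close>, so that partial derivatives there
  are all given by the same parameter integral.\<close>

lemma axis_translates_in_open:
  fixes D :: "(complex^'n) set"
  assumes "open D" "p \<in> D"
  obtains s where "0 < s" "\<And>q t i. q \<in> ball p s \<Longrightarrow> cmod t < 2 * s \<Longrightarrow> q + axis i t \<in> D"
proof -
  from assms obtain e where e: "e > 0" "ball p e \<subseteq> D" by (auto simp: open_contains_ball)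
  show thesis
  proof
    show "0 < e / 3" using e by simp
    fix q :: "complex^'n" and t i assume q: "q \<in> ball p (e / 3)" and t: "cmod t < 2 * (e / 3)"
    have "norm (p - q - axis i t) \<le> norm (p - q) + norm (axis i t :: complex^'n)" by (rule norm_triangle_ineq4)
    then have "q + axis i t \<in> ball p e"
      using q t by (simp add: dist_norm norm_axis_complex algebra_simps)
    with e show "q + axis i t \<in> D" by auto
  qed
qed

lemma continuous_on_circle_integrand:
  fixes g :: "complex^'n \<Rightarrow> complex"
  assumes g: "continuous_on D g" and s: "0 < s"
    and in_D: "\<And>q t. q \<in> B \<Longrightarrow> cmod t < 2 * s \<Longrightarrow> q + axis i t \<in> D"
  shows "continuous_on (B \<times> cbox 0 1) (\<lambda>(q,\<theta>). g (q + axis i (circ s \<theta>)) * (1 / circ s \<theta>))"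
proof -
  have "circ s \<theta> \<noteq> 0" for \<theta> using norm_circ[OF s, of \<theta>] s by auto
  moreover have cont: "continuous_on (B \<times> cbox 0 1) (\<lambda>x. circ s (snd x))"
    unfolding circ_def by (intro continuous_intros)
  moreover have "continuous_on (B \<times> cbox 0 1) (\<lambda>x. g (fst x + axis i (circ s (snd x))))"
    by (rule continuous_on_compose2[OF g])
       (use s in \<open>auto intro!: continuous_intros cont[simplified] in_D simp: norm_circ\<close>)
  ultimately show ?thesis
    unfolding split_beta by (intro continuous_intros) auto
qed

text \<open>Locally the partial derivative is a circle integral whose integrand depends continuously
  on the base point.\<close>

lemma continuous_on_partial:
  fixes f :: "complex^'n \<Rightarrow> complex"
  assumes D: "open D" and f: "hol_on f D"
  shows "continuous_on D (partial i f)"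
proof (rule continuous_at_imp_continuous_on, rule ballI)
  fix p assume "p \<in> D"
  obtain s where s: "0 < s" and in_D: "\<And>q t. q \<in> ball p s \<Longrightarrow> cmod t < 2 * s \<Longrightarrow> q + axis i t \<in> D"
    using axis_translates_in_open[OF D \<open>p \<in> D\<close>] by metis
  have "continuous_on (ball p s) (\<lambda>q. integral (cbox 0 1) (\<lambda>\<theta>. f (q + axis i (circ s \<theta>)) * (1 / circ s \<theta>)))"
  proof (rule integral_continuous_on_param)
    show "continuous_on (ball p s \<times> cbox 0 1) (\<lambda>(q,\<theta>). f (q + axis i (circ s \<theta>)) * (1 / circ s \<theta>))"
      by (rule continuous_on_circle_integrand[OF hol_on_continuous[OF f] s in_D])
  qed
  moreover have "integral (cbox 0 1) (\<lambda>\<theta>. f (q + axis i (circ s \<theta>)) * (1 / circ s \<theta>)) = partial i f q"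
    if "q \<in> ball p s" for q
    unfolding box_real using s
    by (intro integral_unique partial_circle_integral[of "2 * s"])
       (auto simp: field_differentiable_def intro!: hol_on_line[OF f] in_D[OF that])
  ultimately have "continuous_on (ball p s) (partial i f)"
    using continuous_on_cong by (metis (no_types, lifting))
  then show "isCont (partial i f) p"
    using s by (simp add: continuous_on_eq_continuous_at)
qed

text \<open>Cauchy's circle integral is differentiated under the integral sign. The coefficients are
  kept explicit because \<open>partial_commute\<close> reads the mixed derivatives off them.\<close>

lemma has_derivative_partial:
  fixes f :: "complex^'n \<Rightarrow> complex"
  assumes D: "open D" and f: "hol_on f D" and "p \<in> D"
  shows "\<exists>s>0. (\<forall>t. cmod t < 2 * s \<longrightarrow> p + axis i t \<in> D) \<and>
    (partial i f has_derivative (\<lambda>h. \<Sum>j\<in>UNIV. integral {0..1}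
       (\<lambda>\<theta>. partial j f (p + axis i (circ s \<theta>)) *
            (1 / circ s \<theta>)) * h $ j)) (at p)"
proof -
  obtain s where s: "0 < s" and in_D: "\<And>q t. q \<in> ball p s \<Longrightarrow> cmod t < 2 * s \<Longrightarrow> q + axis i t \<in> D"
    using axis_translates_in_open[OF D \<open>p \<in> D\<close>] by metis
  have int_eq: "integral (cbox 0 1) (\<lambda>\<theta>. f (q + axis i (circ s \<theta>)) * (1 / circ s \<theta>)) = partial i f q"
    if "q \<in> ball p s" for q
    unfolding box_real using s
    by (intro integral_unique partial_circle_integral[of "2 * s"])
       (auto simp: field_differentiable_def intro!: hol_on_line[OF f] in_D[OF that])
  have cont: "continuous_on (ball p s \<times> cbox 0 1) (\<lambda>(q,\<theta>). g (q + axis i (circ s \<theta>)) * (1 / circ s \<theta>))"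
    if "continuous_on D g" for g
    by (rule continuous_on_circle_integrand[OF that s in_D])
  have cont1: "continuous_on {0..1} (\<lambda>\<theta>. g (q + axis i (circ s \<theta>)) * (1 / circ s \<theta>))"
    if "continuous_on D g" "q \<in> ball p s" for g q
  proof -
    have "continuous_on {0..1} (Pair q)" by (intro continuous_intros)
    then show ?thesis
      using continuous_on_compose2[OF cont[OF that(1)], of "{0..1}" "Pair q"] that(2)
      by (simp add: box_real image_subset_iff)
  qed
  \<comment> \<open>The Leibniz rule takes the derivative of the integrand as a continuous family of
    bounded linear operators, so the coordinate projections are packaged as such.\<close>
  define nthb :: "'n \<Rightarrow> (complex^'n) \<Rightarrow>\<^sub>L complex" where "nthb = (\<lambda>j. Blinfun (\<lambda>h. h $ j))"
  have nthb: "blinfun_apply (nthb j) h = h $ j" for j h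
    unfolding nthb_def by (subst bounded_linear_Blinfun_apply) (auto intro: bounded_linear_vec_nth)
  define F where "F = (\<lambda>q \<theta>. \<Sum>j\<in>UNIV. blinfun_mult_right (partial j f (q + axis i (circ s \<theta>)) * (1 / circ s \<theta>)) o\<^sub>L nthb j)"
  have contF: "continuous_on (ball p s \<times> cbox 0 1) (\<lambda>(q,\<theta>). F q \<theta>)"
    unfolding F_def split_beta
    by (intro continuous_on_sum bounded_bilinear.continuous_on[OF bounded_bilinear_blinfun_compose]
           continuous_on_const bounded_linear.continuous_on[OF bounded_linear_blinfun_mult_right]
           cont[OF continuous_on_partial[OF D f], unfolded split_beta])
  have F_apply: "blinfun_apply (F q \<theta>) h = (\<Sum>j\<in>UNIV. partial j f (q + axis i (circ s \<theta>)) * h $ j) * (1 / circ s \<theta>)" for q \<theta> h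
    unfolding F_def by (simp add: blinfun.sum_left nthb sum_distrib_right mult_ac sum_divide_distrib)
  have "((\<lambda>q. integral (cbox 0 1) (\<lambda>\<theta>. f (q + axis i (circ s \<theta>)) * (1 / circ s \<theta>)))
          has_derivative blinfun_apply (integral (cbox 0 1) (F p))) (at p within ball p s)"
  proof (rule leibniz_rule)
    fix q \<theta> assume q: "q \<in> ball p s" and "\<theta> \<in> cbox (0::real) 1"
    have "q + axis i (circ s \<theta>) \<in> D" using in_D[OF q] s by (simp add: norm_circ)
    from hol_on_has_derivative[OF f this]
    have "((\<lambda>q. f (q + axis i (circ s \<theta>))) has_derivative (\<lambda>h. \<Sum>j\<in>UNIV. partial j f (q + axis i (circ s \<theta>)) * h $ j)) (at q)"
      using diff_chain_at[OF has_derivative_add_const[OF has_derivative_ident], of f _ q "axis i (circ s \<theta>)"]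
      by (simp add: o_def)
    from has_derivative_mult_left[OF this, of "1 / circ s \<theta>"]
    show "((\<lambda>q. f (q + axis i (circ s \<theta>)) * (1 / circ s \<theta>)) has_derivative blinfun_apply (F q \<theta>)) (at q within ball p s)"
      unfolding F_apply[abs_def] by (rule has_derivative_at_withinI)
  next
    fix q assume "q \<in> ball p s"
    then show "(\<lambda>\<theta>. f (q + axis i (circ s \<theta>)) * (1 / circ s \<theta>)) integrable_on cbox 0 1"
      unfolding box_real by (intro integrable_continuous_real cont1 hol_on_continuous f)
  qed (use contF s in auto)
  then have "(partial i f has_derivative blinfun_apply (integral (cbox 0 1) (F p))) (at p within ball p s)"
    by (rule has_derivative_transform[rotated 2]) (use s int_eq in auto)
  then have D: "(partial i f has_derivative blinfun_apply (integral (cbox 0 1) (F p))) (at p)"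
    using s by (simp add: at_within_open[of p "ball p s"])
  have "continuous_on {0..1} (F p)"
  proof -
    have "continuous_on {0..1} (Pair p)" by (intro continuous_intros)
    then show ?thesis
      using continuous_on_compose2[OF contF, of "{0..1}" "Pair p"] s by (simp add: box_real image_subset_iff)
  qed
  then have "F p integrable_on cbox 0 1" unfolding box_real by (rule integrable_continuous_real)
  then have "blinfun_apply (integral (cbox 0 1) (F p)) h = integral {0..1} (\<lambda>\<theta>. blinfun_apply (F p \<theta>) h)" for h
    using blinfun_apply_integral by (metis box_real(2))
  also have "integral {0..1} (\<lambda>\<theta>. blinfun_apply (F p \<theta>) h)
     = (\<Sum>j\<in>UNIV. integral {0..1} (\<lambda>\<theta>. partial j f (p + axis i (circ s \<theta>)) * (1 / circ s \<theta>)) * h $ j)" for h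
  proof -
    have "(\<lambda>\<theta>. partial j f (p + axis i (circ s \<theta>)) * (1 / circ s \<theta>)) integrable_on {0..1}" for j
      using cont1[OF continuous_on_partial[OF \<open>open D\<close> f], of p] s by (auto intro!: integrable_continuous_real)
    then have "((\<lambda>\<theta>. \<Sum>j\<in>UNIV. partial j f (p + axis i (circ s \<theta>)) * (1 / circ s \<theta>) * h $ j) has_integral
      (\<Sum>j\<in>UNIV. integral {0..1} (\<lambda>\<theta>. partial j f (p + axis i (circ s \<theta>)) * (1 / circ s \<theta>)) * h $ j)) {0..1}"
      by (intro has_integral_sum has_integral_mult_left) auto
    then show ?thesis
      by (intro integral_unique) (simp add: F_apply sum_distrib_right sum_divide_distrib mult_ac)
  qed
  finally have "blinfun_apply (integral (cbox 0 1) (F p)) =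
    (\<lambda>h. \<Sum>j\<in>UNIV. integral {0..1} (\<lambda>\<theta>. partial j f (p + axis i (circ s \<theta>)) * (1 / circ s \<theta>)) * h $ j)" by blast
  with D have "(partial i f has_derivative (\<lambda>h. \<Sum>j\<in>UNIV. integral {0..1} (\<lambda>\<theta>. partial j f (p + axis i (circ s \<theta>)) * (1 / circ s \<theta>)) * h $ j)) (at p)"
    by simp
  then show ?thesis
    using s in_D[of p] by (intro exI[of _ s]) auto
qed

lemma hol_on_partial:
  fixes f :: "complex^'n \<Rightarrow> complex"
  assumes "open D" "hol_on f D"
  shows "hol_on (partial i f) D"
  unfolding hol_on_def
proof
  fix p assume "p \<in> D"
  from has_derivative_partial[OF assms this, of i] have
    "\<exists>b. (partial i f has_derivative (\<lambda>h. \<Sum>j\<in>UNIV. b j * h $ j)) (at p)" by (elim exE conjE) (rule exI)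
  then obtain b where "(partial i f has_derivative (\<lambda>h. \<Sum>j\<in>UNIV. b j * h $ j)) (at p)" ..
  then show "\<exists>a. (partial i f has_derivative (\<lambda>h. \<Sum>j\<in>UNIV. a $ j * h $ j)) (at p)"
    by (intro exI[of _ "\<chi> j. b j"]) simp
qed

text \<open>The left side is the circle integral of \<open>partial j f\<close>; Cauchy's formula,
  now applied to \<open>partial j f\<close>, identifies this integral with the right side.\<close>

lemma partial_commute:
  fixes f :: "complex^'n \<Rightarrow> complex"
  assumes D: "open D" and f: "hol_on f D" and p: "p \<in> D"
  shows "partial j (partial i f) p = partial i (partial j f) p"
proof -
  from has_derivative_partial[OF assms, of i] obtain s where s: "s > 0"
    and in_D: "\<And>t. cmod t < 2 * s \<Longrightarrow> p + axis i t \<in> D"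
    and der: "(partial i f has_derivative
       (\<lambda>h. \<Sum>j\<in>UNIV. integral {0..1} (\<lambda>\<theta>. partial j f (p + axis i (circ s \<theta>)) * (1 / circ s \<theta>)) * h $ j)) (at p)"
    by blast
  have "partial j (partial i f) p = integral {0..1} (\<lambda>\<theta>. partial j f (p + axis i (circ s \<theta>)) * (1 / circ s \<theta>))"
    using has_field_derivative_line[of "partial i f" "\<chi> j. integral {0..1} (\<lambda>\<theta>. partial j f (p + axis i (circ s \<theta>)) * (1 / circ s \<theta>))" p j 0] der
    by (intro partial_eqI) (simp add: axis_zero)
  also have "\<dots> = partial i (partial j f) p"
    using s
    by (intro integral_unique partial_circle_integral[of "2 * s"])
       (auto simp: field_differentiable_def intro!: hol_on_line[OF hol_on_partial[OF D f]] in_D)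
  finally show ?thesis .
qed

lemma partial_cong_open:
  fixes p :: "complex^'n"
  assumes "open D" "p \<in> D" "\<And>q. q \<in> D \<Longrightarrow> f q = g q"
  shows "partial i f p = partial i g p"
proof -
  have "isCont (\<lambda>t. p + axis i t :: complex^'n) 0"
    by (intro continuous_intros bounded_linear.isCont[OF bounded_linear_axis])
  then have "\<forall>\<^sub>F t in nhds 0. p + axis i t \<in> D"
    using assms(1,2) by (auto simp: isCont_def axis_zero tendsto_def eventually_at_filter elim!: allE[of _ D] eventually_mono)
  then show ?thesis
    unfolding partial_def by (intro deriv_cong_ev) (auto simp: assms(3) elim!: eventually_mono)
qed

lemma partial_nth: "partial i (\<lambda>q. q $ j) p = (if i = j then 1 else 0)"
  by (rule partial_eqI) (auto simp: axis_def intro!: derivative_eq_intros)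

lemma hol_on_mult:
  assumes "hol_on f D" "hol_on g D"
  shows "hol_on (\<lambda>p. f p * g p) D"
  unfolding hol_on_def
proof
  fix p assume "p \<in> D"
  show "\<exists>a. ((\<lambda>p. f p * g p) has_derivative (\<lambda>h. \<Sum>j\<in>UNIV. a $ j * h $ j)) (at p)"
    using has_derivative_mult[OF hol_on_has_derivative[OF assms(1) \<open>p \<in> D\<close>] hol_on_has_derivative[OF assms(2) \<open>p \<in> D\<close>]]
    by (intro exI[of _ "\<chi> j. f p * partial j g p + partial j f p * g p"])
       (simp add: sum_distrib_left sum_distrib_right sum.distrib[symmetric] algebra_simps)
qed

lemma hol_on_diff:
  assumes "hol_on f D" "hol_on g D"
  shows "hol_on (\<lambda>p. f p - g p) D"
  unfolding hol_on_def
proof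
  fix p assume "p \<in> D"
  show "\<exists>a. ((\<lambda>p. f p - g p) has_derivative (\<lambda>h. \<Sum>j\<in>UNIV. a $ j * h $ j)) (at p)"
    using has_derivative_diff[OF hol_on_has_derivative[OF assms(1) \<open>p \<in> D\<close>] hol_on_has_derivative[OF assms(2) \<open>p \<in> D\<close>]]
    by (intro exI[of _ "\<chi> j. partial j f p - partial j g p"])
       (simp add: sum_subtractf algebra_simps)
qed

lemma hol_on_subset: "hol_on f D \<Longrightarrow> E \<subseteq> D \<Longrightarrow> hol_on f E"
  by (auto simp: hol_on_def)

section \<open>The transverse Jacobian as a first integral\<close>

text \<open>For a fibered map the first row of the Jacobian matrix is (1, 0, 0), so this minor is
  the full determinant.\<close>

definition yjac :: "(complex^3 \<Rightarrow> complex^3) \<Rightarrow> complex^3 \<Rightarrow> complex" where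
  "yjac \<Phi> p = partial 2 (\<lambda>q. \<Phi> q $ 2) p * partial 3 (\<lambda>q. \<Phi> q $ 3) p
            - partial 3 (\<lambda>q. \<Phi> q $ 2) p * partial 2 (\<lambda>q. \<Phi> q $ 3) p"

lemma hol_on_yjac:
  assumes "open D" "hol_map_on \<Phi> D"
  shows "hol_on (yjac \<Phi>) D"
proof -
  have "hol_on (\<lambda>q. \<Phi> q $ m) D" for m
    using assms(2) by (simp add: hol_map_on_def)
  then have "hol_on (\<lambda>p. partial 2 (\<lambda>q. \<Phi> q $ 2) p * partial 3 (\<lambda>q. \<Phi> q $ 3) p
            - partial 3 (\<lambda>q. \<Phi> q $ 2) p * partial 2 (\<lambda>q. \<Phi> q $ 3) p) D"
    by (intro hol_on_diff hol_on_mult hol_on_partial assms(1))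
  then show ?thesis by (simp add: yjac_def[abs_def])
qed

lemma partial_fibered:
  assumes "open D" "fibered_on D \<Phi>" "p \<in> D"
  shows "partial i (\<lambda>q. \<Phi> q $ 1) p = (if i = 1 then 1 else 0)"
  using partial_cong_open[OF assms(1,3), of "\<lambda>q. \<Phi> q $ 1" "\<lambda>q. q $ 1" i] assms(2)
  by (simp add: fibered_on_def partial_nth)

text \<open>Evaluating at the image of \<open>p\<close> removes the inverse from
  \<open>pushforward\<close> and leaves an identity on \<open>D\<close> that can be
  differentiated.\<close>

lemma pushforward_conjugacy:
  assumes "inj_on \<Phi> D" "\<forall>q\<in>\<Phi> ` D. pushforward D \<Phi> Y q = Z q" "p \<in> D"
  shows "(\<Sum>k\<in>UNIV. partial k (\<lambda>q. \<Phi> q $ m) p * Y p $ k) = Z (\<Phi> p) $ m"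
proof -
  have "cjacobian \<Phi> p *v Y p = Z (\<Phi> p)"
    using assms by (auto simp: pushforward_def Let_def)
  then have "(cjacobian \<Phi> p *v Y p) $ m = Z (\<Phi> p) $ m" by simp
  then show ?thesis by (simp add: matrix_vector_mult_def cjacobian_def)
qed

text \<open>A form \<open>wedge dx\<close> has no component on \<open>dy1\<close>,
  \<open>dy2\<close>, and for the Lie derivative of \<open>omega\<close> this component is the
  transverse divergence over x, minus \<open>Y p $ 1\<close> over x^2. When that first component is
  x^2, the divergence is x.\<close>

lemma divergence_relation:
  fixes Y :: "complex^3 \<Rightarrow> complex^3"
  assumes "transv_hamiltonian_on W Y" "open W" "p \<in> W" "p $ 1 \<noteq> 0"
  shows "p $ 1 * (partial 2 (\<lambda>q. Y q $ 2) p + partial 3 (\<lambda>q. Y q $ 3) p) = Y p $ 1"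
proof -
  from assms obtain \<alpha> where \<alpha>: "\<forall>p\<in>W. p $ 1 \<noteq> 0 \<longrightarrow> lie2 Y omega p = wedge dx (\<alpha> p)"
    unfolding transv_hamiltonian_on_def in_ideal_dx2_def by blast
  have "lie2 Y omega p $ 2 $ 3 = 0"
    using \<alpha> assms by (simp add: wedge_def axis_def)
  moreover have "partial k (\<lambda>q. omega q $ 2 $ 3) p = (if k = 1 then - 1 / (p $ 1)\<^sup>2 else 0)" for k
    using assms(4)
    by (intro partial_eqI) (auto simp: omega_def wedge_def axis_def power2_eq_square intro!: derivative_eq_intros)
  moreover have "omega p $ i $ j = (if i = 2 \<and> j = 3 then 1 / p $ 1 else if i = 3 \<and> j = 2 then - 1 / p $ 1 else 0)" for i j
    by (auto simp: omega_def wedge_def axis_def)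
  ultimately have "- Y p $ 1 / (p $ 1)\<^sup>2 + partial 2 (\<lambda>q. Y q $ 2) p / p $ 1 + partial 3 (\<lambda>q. Y q $ 3) p / p $ 1 = 0"
    by (simp add: lie2_def sum_3)
  then show ?thesis
    using assms(4) by (simp add: field_simps power2_eq_square)
qed

text \<open>Liouville's formula: the hypotheses say M' = A M - M B for the matrix M with rows (a, b)
  and (c, d), so det M evolves with the factor tr A - tr B, which is 0.\<close>

lemma det2_evolution:
  fixes a b c d :: "'a::comm_ring_1"
  assumes "a' + (a * B22 + b * B32) = A22 * a + A23 * c" "b' + (a * B23 + b * B33) = A22 * b + A23 * d"
    and "c' + (c * B22 + d * B32) = A32 * a + A33 * c" "d' + (c * B23 + d * B33) = A32 * b + A33 * d"
    and "A22 + A33 = B22 + B33"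
  shows "a' * d + a * d' - b' * c - b * c' = 0"
proof -
  note eqs = assms(1-4)[folded eq_diff_eq]
  have "a' * d + a * d' - b' * c - b * c' = (A22 + A33 - (B22 + B33)) * (a * d - b * c)"
    unfolding eqs by (simp add: algebra_simps)
  then show ?thesis using assms(5) by simp
qed

text \<open>Differentiating the conjugacy in the y directions shows that the transverse block of the
  Jacobian matrix satisfies the equation of \<open>det2_evolution\<close> along \<open>Y\<close>,
  with A and B the transverse linear parts of the normal form and of \<open>Y\<close>. Both traces
  are x.\<close>

lemma yjac_first_integral:
  fixes Y \<Phi> :: "complex^3 \<Rightarrow> complex^3"
  assumes D: "open D" and Y: "hol_map_on Y D" and \<Phi>: "hol_map_on \<Phi> D"
    and inj: "inj_on \<Phi> D" and fib: "fibered_on D \<Phi>"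
    and conj: "\<forall>q\<in>\<Phi> ` D. ereal (cmod (q $ 2 * q $ 3)) < fps_conv_radius c \<and>
           pushforward D \<Phi> Y q = Ynorm lam a1 a2 c q"
    and a: "a1 + a2 = 1"
    and p: "p \<in> D" and div: "partial 2 (\<lambda>q. Y q $ 2) p + partial 3 (\<lambda>q. Y q $ 3) p = p $ 1"
  shows "(\<Sum>k\<in>UNIV. partial k (yjac \<Phi>) p * Y p $ k) = 0"
proof -
  define P where "P = (\<lambda>m q. \<Phi> q $ m)"
  define X where "X = (\<lambda>m q. Y q $ m)"
  define e where "e = eval_fps c (P 2 p * P 3 p)"
  define e' where "e' = eval_fps (fps_deriv c) (P 2 p * P 3 p)"
  have holP: "hol_on (P m) D" and holX: "hol_on (X m) D" for m
    using \<Phi> Y by (simp_all add: P_def X_def hol_map_on_def)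
  have conj': "(\<Sum>k\<in>UNIV. partial k (P m) q * X k q) = Ynorm lam a1 a2 c (\<Phi> q) $ m" if "q \<in> D" for q m
    unfolding P_def X_def
    by (rule pushforward_conjugacy[OF inj _ that]) (use conj in blast)
  have P1: "P 1 q = q $ 1" if "q \<in> D" for q
    using fib that by (simp add: P_def fibered_on_def)
  have dP1: "partial i (P 1) q = (if i = 1 then 1 else 0)" if "q \<in> D" for i q
    unfolding P_def by (rule partial_fibered[OF D fib that])
  have X1: "X 1 q = (q $ 1)\<^sup>2" if "q \<in> D" for q
    using conj'[OF that, of 1] dP1[OF that] P1[OF that] by (simp add: sum_3 Ynorm_def P_def)
  \<comment> \<open>The x component of \<open>Y\<close> depends on x alone, so no x derivative of
    \<Phi> enters the equations for the transverse block.\<close>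
  have dX1: "partial j (X 1) p = 0" if "j \<noteq> 1" for j
  proof -
    have "partial j (X 1) p = partial j (\<lambda>q. (q $ 1)\<^sup>2) p"
      by (rule partial_cong_open[OF D p X1])
    also have "\<dots> = 0"
      using that by (intro partial_eqI) (auto simp: axis_def)
    finally show ?thesis .
  qed
  \<comment> \<open>Exchanging the mixed derivatives turns the second order terms into the
    derivative along \<open>Y\<close> of the entry \<open>partial j (P m)\<close>.\<close>
  have dconj: "(\<Sum>k\<in>UNIV. partial k (partial j (P m)) p * X k p + partial k (P m) p * partial j (X k) p)
      = partial j (\<lambda>q. Ynorm lam a1 a2 c (\<Phi> q) $ m) p" for j m
  proof -
    have "partial j (\<lambda>q. Ynorm lam a1 a2 c (\<Phi> q) $ m) p = partial j (\<lambda>q. \<Sum>k\<in>UNIV. partial k (P m) q * X k q) p"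
      by (rule partial_cong_open[OF D p]) (simp add: conj')
    also have "\<dots> = (\<Sum>k\<in>UNIV. partial j (partial k (P m)) p * X k p + partial k (P m) p * partial j (X k) p)"
    proof (rule partial_eqI)
      show "((\<lambda>t. \<Sum>k\<in>UNIV. partial k (P m) (p + axis j t) * X k (p + axis j t)) has_field_derivative
        (\<Sum>k\<in>UNIV. partial j (partial k (P m)) p * X k p + partial k (P m) p * partial j (X k) p)) (at 0)"
      proof (rule DERIV_sum)
        fix k
        show "((\<lambda>t. partial k (P m) (p + axis j t) * X k (p + axis j t)) has_field_derivative
          partial j (partial k (P m)) p * X k p + partial k (P m) p * partial j (X k) p) (at 0)"
          using DERIV_mult[OF hol_on_partial_derivative[OF hol_on_partial[OF D holP] p] hol_on_partial_derivative[OF holX p], of k m j k j]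
          by (simp add: axis_zero algebra_simps)
      qed
    qed
    finally show ?thesis by (simp add: partial_commute[OF D holP p, of j])
  qed
  have derP: "((\<lambda>t. P m (p + axis j t)) has_field_derivative partial j (P m) p) (at 0)" for m j
    by (rule hol_on_partial_derivative[OF holP p])
  have rad: "ereal (cmod (P 2 p * P 3 p)) < fps_conv_radius c"
    using conj p by (auto simp: P_def)
  have dere: "((\<lambda>t. eval_fps c (P 2 (p + axis j t) * P 3 (p + axis j t))) has_field_derivative
      e' * (partial j (P 2) p * P 3 p + partial j (P 3) p * P 2 p)) (at 0)" for j
  proof -
    have 1: "(eval_fps c has_field_derivative e') (at (P 2 (p + axis j 0) * P 3 (p + axis j 0)))"
      using has_field_derivative_eval_fps[OF rad] by (simp add: e'_def axis_zero)
    from DERIV_chain2[OF 1 DERIV_mult[OF derP derP]]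
    show ?thesis by (simp add: axis_zero)
  qed
  have N2: "partial j (\<lambda>q. Ynorm lam a1 a2 c (\<Phi> q) $ 2) p =
      (- lam + a1 * p $ 1 - e) * partial j (P 2) p
      - e' * (partial j (P 2) p * P 3 p + partial j (P 3) p * P 2 p) * P 2 p" if "j \<noteq> 1" for j
  proof (rule partial_eqI)
    have "((\<lambda>t. (- lam + a1 * P 1 (p + axis j t) - eval_fps c (P 2 (p + axis j t) * P 3 (p + axis j t))) * P 2 (p + axis j t))
       has_field_derivative (- lam + a1 * p $ 1 - e) * partial j (P 2) p
      - e' * (partial j (P 2) p * P 3 p + partial j (P 3) p * P 2 p) * P 2 p) (at 0)"
      by (rule derivative_eq_intros derP dere refl)+ (simp add: axis_zero dP1[OF p] P1[OF p] that e_def algebra_simps)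
    then show "((\<lambda>t. Ynorm lam a1 a2 c (\<Phi> (p + axis j t)) $ 2) has_field_derivative 
      (- lam + a1 * p $ 1 - e) * partial j (P 2) p
      - e' * (partial j (P 2) p * P 3 p + partial j (P 3) p * P 2 p) * P 2 p) (at 0)"
      by (simp add: Ynorm_def P_def)
  qed
  have N3: "partial j (\<lambda>q. Ynorm lam a1 a2 c (\<Phi> q) $ 3) p =
      (lam + a2 * p $ 1 + e) * partial j (P 3) p
      + e' * (partial j (P 2) p * P 3 p + partial j (P 3) p * P 2 p) * P 3 p" if "j \<noteq> 1" for j
  proof (rule partial_eqI)
    have "((\<lambda>t. (lam + a2 * P 1 (p + axis j t) + eval_fps c (P 2 (p + axis j t) * P 3 (p + axis j t))) * P 3 (p + axis j t))
       has_field_derivative (lam + a2 * p $ 1 + e) * partial j (P 3) p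
      + e' * (partial j (P 2) p * P 3 p + partial j (P 3) p * P 2 p) * P 3 p) (at 0)"
      by (rule derivative_eq_intros derP dere refl)+ (simp add: axis_zero dP1[OF p] P1[OF p] that e_def algebra_simps)
    then show "((\<lambda>t. Ynorm lam a1 a2 c (\<Phi> (p + axis j t)) $ 3) has_field_derivative 
      (lam + a2 * p $ 1 + e) * partial j (P 3) p
      + e' * (partial j (P 2) p * P 3 p + partial j (P 3) p * P 2 p) * P 3 p) (at 0)"
      by (simp add: Ynorm_def P_def)
  qed
  have dJ: "partial k (yjac \<Phi>) p =
     partial k (partial 2 (P 2)) p * partial 3 (P 3) p + partial 2 (P 2) p * partial k (partial 3 (P 3)) p
   - partial k (partial 3 (P 2)) p * partial 2 (P 3) p - partial 3 (P 2) p * partial k (partial 2 (P 3)) p" for k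
  proof (rule partial_eqI)
    have d: "((\<lambda>t. partial i (P m) (p + axis k t)) has_field_derivative partial k (partial i (P m)) p) (at 0)" for i m
      by (rule hol_on_partial_derivative[OF hol_on_partial[OF D holP] p])
    have "((\<lambda>t. partial 2 (P 2) (p + axis k t) * partial 3 (P 3) (p + axis k t)
            - partial 3 (P 2) (p + axis k t) * partial 2 (P 3) (p + axis k t)) has_field_derivative
     partial k (partial 2 (P 2)) p * partial 3 (P 3) p + partial 2 (P 2) p * partial k (partial 3 (P 3)) p
   - partial k (partial 3 (P 2)) p * partial 2 (P 3) p - partial 3 (P 2) p * partial k (partial 2 (P 3)) p) (at 0)"
      by (rule derivative_eq_intros d refl)+ (simp add: axis_zero algebra_simps)
    then show "((\<lambda>t. yjac \<Phi> (p + axis k t)) has_field_derivative 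
     partial k (partial 2 (P 2)) p * partial 3 (P 3) p + partial 2 (P 2) p * partial k (partial 3 (P 3)) p
   - partial k (partial 3 (P 2)) p * partial 2 (P 3) p - partial 3 (P 2) p * partial k (partial 2 (P 3)) p) (at 0)"
      by (simp add: yjac_def P_def)
  qed
  have div': "partial 2 (X 2) p + partial 3 (X 3) p = p $ 1"
    using div by (simp add: X_def)
  \<comment> \<open>The derivative along \<open>Y\<close> of an entry of the transverse block, which
    plays the role of a', b', c', d' in \<open>det2_evolution\<close>.\<close>
  define V where "V = (\<lambda>j m. \<Sum>k\<in>UNIV. partial k (partial j (P m)) p * X k p)"
  have V: "V j m + (partial 2 (P m) p * partial j (X 2) p + partial 3 (P m) p * partial j (X 3) p)
      = partial j (\<lambda>q. Ynorm lam a1 a2 c (\<Phi> q) $ m) p" if "j \<noteq> 1" for j m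
    using dconj[of j m] dX1[OF that] by (simp add: V_def sum_3 sum.distrib algebra_simps)
  have "V 2 2 * partial 3 (P 3) p + partial 2 (P 2) p * V 3 3
      - V 3 2 * partial 2 (P 3) p - partial 3 (P 2) p * V 2 3 = 0"
  proof (rule det2_evolution)
    \<comment> \<open>Entries of the y derivative of the normal form at the image point, where
      \<open>e\<close> and \<open>e'\<close> are the values of c and of its derivative.\<close>
    let ?A22 = "- lam + a1 * p $ 1 - e - e' * P 3 p * P 2 p" and ?A23 = "- e' * P 2 p * P 2 p"
    let ?A32 = "e' * P 3 p * P 3 p" and ?A33 = "lam + a2 * p $ 1 + e + e' * P 3 p * P 2 p"
    show "V 2 2 + (partial 2 (P 2) p * partial 2 (X 2) p + partial 3 (P 2) p * partial 2 (X 3) p)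
        = ?A22 * partial 2 (P 2) p + ?A23 * partial 2 (P 3) p"
      and "V 3 2 + (partial 2 (P 2) p * partial 3 (X 2) p + partial 3 (P 2) p * partial 3 (X 3) p)
        = ?A22 * partial 3 (P 2) p + ?A23 * partial 3 (P 3) p"
      and "V 2 3 + (partial 2 (P 3) p * partial 2 (X 2) p + partial 3 (P 3) p * partial 2 (X 3) p)
        = ?A32 * partial 2 (P 2) p + ?A33 * partial 2 (P 3) p"
      and "V 3 3 + (partial 2 (P 3) p * partial 3 (X 2) p + partial 3 (P 3) p * partial 3 (X 3) p)
        = ?A32 * partial 3 (P 2) p + ?A33 * partial 3 (P 3) p"
      by (subst V, simp, (subst N2 | subst N3), simp, simp add: algebra_simps)+
    \<comment> \<open>The contributions of c cancel in the trace; this uses that c enters the two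
      components with opposite signs.\<close>
    have "?A22 + ?A33 = (a1 + a2) * p $ 1" by (simp add: algebra_simps)
    then show "?A22 + ?A33 = partial 2 (X 2) p + partial 3 (X 3) p" using a div' by simp
  qed
  moreover have "(\<Sum>k\<in>UNIV. partial k (yjac \<Phi>) p * Y p $ k) =
     V 2 2 * partial 3 (P 3) p + partial 2 (P 2) p * V 3 3
      - V 3 2 * partial 2 (P 3) p - partial 3 (P 2) p * V 2 3"
    by (simp add: dJ V_def sum_3 X_def algebra_simps)
  ultimately show ?thesis by simp
qed


section \<open>Maps tangent to the identity on sectorial domains\<close>

lemma norm_le_sum3: "norm (p :: complex^3) \<le> cmod (p $ 1) + cmod (p $ 2) + cmod (p $ 3)"
  using L2_set_le_sum[of UNIV "\<lambda>i. cmod (p $ i)"] by (simp add: norm_vec_def sum_3)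

section \<open>Topology of sectors and sectorial domains\<close>

text \<open>In the logarithmic coordinate a sector is a convex half-strip, which makes its
  connectedness immediate. The bound on \<beta> keeps the strip within the principal branch.\<close>

lemma sector_eq_image_exp:
  assumes "d \<noteq> 0" "0 < r" "\<beta> \<le> pi"
  shows "sector d \<beta> r = (\<lambda>w. d * exp w) ` {w. Re w < ln (r / cmod d) \<and> - \<beta> < Im w \<and> Im w < \<beta>}"
proof (intro set_eqI iffI)
  fix x assume x: "x \<in> sector d \<beta> r"
  then have "x / d \<noteq> 0" using assms by (auto simp: sector_def)
  moreover have "Re (Ln (x / d)) < ln (r / cmod d)"
    using x assms by (auto simp: sector_def norm_divide divide_strict_right_mono)
  moreover have "Im (Ln (x / d)) = Arg (x / d)" using \<open>x / d \<noteq> 0\<close> by (simp add: Arg_eq_Im_Ln)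
  ultimately show "x \<in> (\<lambda>w. d * exp w) ` {w. Re w < ln (r / cmod d) \<and> - \<beta> < Im w \<and> Im w < \<beta>}"
    using x assms by (intro image_eqI[of _ _ "Ln (x / d)"]) (auto simp: sector_def)
next
  fix x assume "x \<in> (\<lambda>w. d * exp w) ` {w. Re w < ln (r / cmod d) \<and> - \<beta> < Im w \<and> Im w < \<beta>}"
  then obtain w where w: "x = d * exp w" "Re w < ln (r / cmod d)" "- \<beta> < Im w" "Im w < \<beta>" by auto
  then have "exp (Re w) < r / cmod d" using assms by (metis divide_pos_pos exp_less_mono exp_ln zero_less_norm_iff)
  moreover have "Arg (exp w) = Im w"
    using w assms by (simp add: Arg_eq_Im_Ln)
  ultimately show "x \<in> sector d \<beta> r"
    using assms w by (simp add: sector_def norm_mult field_simps abs_less_iff)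
qed

lemma connected_sector:
  assumes "d \<noteq> 0" "0 < r" "\<beta> \<le> pi"
  shows "connected (sector d \<beta> r)"
proof -
  let ?W = "{w. Re w < ln (r / cmod d)} \<inter> ({w. - \<beta> < Im w} \<inter> {w. Im w < \<beta>})"
  have "convex ?W"
    by (intro convex_Int convex_halfspace_Re_lt convex_halfspace_Im_gt convex_halfspace_Im_lt)
  then have "connected ((\<lambda>w. d * exp w) ` ?W)"
    by (rule connected_continuous_image[rotated, OF convex_connected]) (intro continuous_intros)
  then show ?thesis
    unfolding sector_eq_image_exp[OF assms] Collect_conj_eq .
qed

text \<open>\<open>Arg\<close> is continuous off the negative axis, and the strict inequality
  \<open>Arg (x / d) < \<beta>\<close> with \<beta> at most pi keeps the sector away from that
  cut.\<close>

lemma open_sector: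
  assumes "d \<noteq> 0" "\<beta> \<le> pi"
  shows "open (sector d \<beta> r)"
proof -
  let ?S = "{x. x / d \<notin> \<real>\<^sub>\<le>\<^sub>0}"
  have "open ((\<lambda>x. x / d) -` (- \<real>\<^sub>\<le>\<^sub>0))"
    by (intro open_vimage continuous_intros) (auto simp: assms)
  then have S: "open ?S" by (simp add: vimage_def)
  have "continuous_on ?S (\<lambda>x. (Arg (x / d), cmod x))"
    by (intro continuous_on_Pair continuous_on_norm continuous_on_id continuous_on_Arg' continuous_on_divide continuous_on_const)
       (use assms in auto)
  from continuous_open_preimage[OF this S open_Times[OF open_greaterThanLessThan open_greaterThanLessThan]]
  have "open (?S \<inter> (\<lambda>x. (Arg (x / d), cmod x)) -` ({-\<beta><..<\<beta>} \<times> {0<..<r}))" .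
  also have "?S \<inter> (\<lambda>x. (Arg (x / d), cmod x)) -` ({-\<beta><..<\<beta>} \<times> {0<..<r}) = sector d \<beta> r"
  proof -
    have "x / d \<notin> \<real>\<^sub>\<le>\<^sub>0" if "x \<noteq> 0" "Arg (x / d) < pi" for x
    proof
      assume "x / d \<in> \<real>\<^sub>\<le>\<^sub>0"
      moreover have "x / d \<noteq> 0" using that assms by simp
      ultimately have "Re (x / d) < 0 \<and> Im (x / d) = 0"
        by (metis complex_eqI complex_nonpos_Reals_iff less_le zero_complex.simps)
      then show False using that Arg_eq_pi[of "x / d"] by simp
    qed
    then show ?thesis using assms by (auto simp: sector_def abs_less_iff)
  qed
  finally show ?thesis .
qed

lemma open_sectorial_domain:
  assumes "d \<noteq> 0" "\<beta> \<le> pi"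
  shows "open (sectorial_domain d \<beta> r \<rho>)"
proof -
  have "open ((\<lambda>p :: complex^3. p $ 1) -` sector d \<beta> r \<inter> (\<lambda>p. p $ 2) -` ball 0 \<rho> \<inter> (\<lambda>p. p $ 3) -` ball 0 \<rho>)"
    by (intro open_Int open_vimage open_sector[OF assms] open_ball continuous_on_component continuous_on_id)
  also have "\<dots> = sectorial_domain d \<beta> r \<rho>"
    by (auto simp: sectorial_domain_def)
  finally show ?thesis .
qed

section \<open>Cauchy estimates and surjectivity for maps close to the identity\<close>

text \<open>Cauchy's inequality for \<Phi> minus the identity on a circle of radius
  \<open>norm p\<close> around \<open>p\<close>: points of the circle have norm at most
  \<open>2 * norm p\<close>, and dividing the quadratic bound by the radius leaves a linear
  one.\<close>

lemma partial_near_identity: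
  fixes \<Phi> :: "complex^'n \<Rightarrow> complex^'n"
  assumes \<Phi>: "hol_map_on \<Phi> D"
    and K: "\<And>q. q \<in> D \<Longrightarrow> norm q \<le> 2 * norm p \<Longrightarrow> norm (\<Phi> q - q) \<le> K * (norm q)\<^sup>2"
    and p: "p \<noteq> 0" and nbhd: "\<And>t. cmod t \<le> norm p \<Longrightarrow> p + axis j t \<in> D"
    and "0 \<le> K"
  shows "cmod (partial j (\<lambda>q. \<Phi> q $ m) p - (if j = m then 1 else 0)) \<le> 4 * K * norm p"
proof -
  define g where "g = (\<lambda>t. \<Phi> (p + axis j t) $ m - (p + axis j t) $ m)"
  have hol: "hol_on (\<lambda>q. \<Phi> q $ m) D" using \<Phi> by (simp add: hol_map_on_def)
  have der: "(g has_field_derivative partial j (\<lambda>q. \<Phi> q $ m) (p + axis j t) - (if j = m then 1 else 0)) (at t)"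
    if "cmod t \<le> norm p" for t
    unfolding g_def
    by (intro DERIV_diff hol_on_line[OF hol nbhd[OF that]])
       (auto simp: axis_def intro!: derivative_eq_intros)
  have cont: "continuous_on (cball 0 (norm p)) g"
    by (intro continuous_at_imp_continuous_on) (auto intro!: DERIV_isCont der)
  have "g holomorphic_on ball 0 (norm p)"
    by (auto simp: holomorphic_on_def field_differentiable_def intro!: exI has_field_derivative_at_within[OF der])
  moreover have "cmod (g t) \<le> K * (2 * norm p)\<^sup>2" if "cmod t = norm p" for t
  proof -
    have "norm (p + axis j t) \<le> 2 * norm p"
      using norm_triangle_ineq[of p "axis j t"] that by (simp add: norm_axis_complex)
    moreover have "cmod (g t) \<le> norm (\<Phi> (p + axis j t) - (p + axis j t))"
      using Finite_Cartesian_Product.norm_nth_le[of "\<Phi> (p + axis j t) - (p + axis j t)" m] by (simp add: g_def)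
    ultimately have "cmod (g t) \<le> K * (norm (p + axis j t))\<^sup>2"
      using K[of "p + axis j t"] nbhd[of t] that by simp
    also have "\<dots> \<le> K * (2 * norm p)\<^sup>2"
      using \<open>norm (p + axis j t) \<le> 2 * norm p\<close> \<open>0 \<le> K\<close> by (intro mult_left_mono power_mono) auto
    finally show ?thesis .
  qed
  ultimately have "cmod ((deriv ^^ 1) g 0) \<le> fact 1 * (K * (2 * norm p)\<^sup>2) / norm p ^ 1"
    using p cont by (intro Cauchy_inequality) auto
  moreover have "deriv g 0 = partial j (\<lambda>q. \<Phi> q $ m) p - (if j = m then 1 else 0)"
    using der[of 0] by (intro DERIV_imp_deriv) (simp add: axis_zero)
  ultimately show ?thesis
    using p by (simp add: power2_eq_square field_simps)
qed

text \<open>Write the transverse block as I + E with entries of E at most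
  \<open>4 * K * norm p\<close>; then det (I + E) - 1 = tr E + det E.\<close>

lemma yjac_near_identity:
  assumes \<Phi>: "hol_map_on \<Phi> (sectorial_domain d \<beta> r \<rho>)"
    and K: "\<And>q. q \<in> sectorial_domain d \<beta> r \<rho> \<Longrightarrow> norm q \<le> 2 * norm p \<Longrightarrow> norm (\<Phi> q - q) \<le> K * (norm q)\<^sup>2"
    and p: "p \<in> sectorial_domain d \<beta> r \<rho>" "2 * norm p < \<rho>" and "0 \<le> K"
  shows "cmod (yjac \<Phi> p - 1) \<le> 8 * K * norm p + 2 * (4 * K * norm p)\<^sup>2"
proof -
  let ?P = "\<lambda>j m. partial j (\<lambda>q. \<Phi> q $ m) p" and ?M = "4 * K * norm p"
  have "p \<noteq> 0" using p by (auto simp: sectorial_domain_def sector_def)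
  have le: "cmod (p $ m) \<le> norm p" for m by (rule Finite_Cartesian_Product.norm_nth_le)
  \<comment> \<open>Only y directions are moved: x stays in its sector, and
    \<open>2 * norm p < \<rho>\<close> keeps the circle inside the polydisc.\<close>
  have nbhd: "p + axis j t \<in> sectorial_domain d \<beta> r \<rho>" if "j \<noteq> 1" "cmod t \<le> norm p" for j t
    using that p le[of 2] le[of 3] norm_triangle_ineq[of "p $ 2" t] norm_triangle_ineq[of "p $ 3" t]
    by (auto simp: sectorial_domain_def axis_def)
  have est: "cmod (?P j m - (if j = m then 1 else 0)) \<le> ?M" if "j \<noteq> 1" for j m
    by (rule partial_near_identity[OF \<Phi> K \<open>p \<noteq> 0\<close> nbhd[OF that] \<open>0 \<le> K\<close>])
  have 22: "cmod (?P 2 2 - 1) \<le> ?M" and 33: "cmod (?P 3 3 - 1) \<le> ?M"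
    and 23: "cmod (?P 2 3) \<le> ?M" and 32: "cmod (?P 3 2) \<le> ?M"
    using est[of 2 2] est[of 3 3] est[of 2 3] est[of 3 2] by simp_all
  have tri: "cmod (s + t + u - v) \<le> cmod s + cmod t + cmod u + cmod v" for s t u v
    using norm_triangle_ineq4[of "s + t + u" v] norm_triangle_ineq[of "s + t" u] norm_triangle_ineq[of s t]
    by linarith
  have "cmod (yjac \<Phi> p - 1) = cmod ((?P 2 2 - 1) + (?P 3 3 - 1) + (?P 2 2 - 1) * (?P 3 3 - 1) - ?P 3 2 * ?P 2 3)"
    by (simp add: yjac_def algebra_simps)
  also have "\<dots> \<le> cmod (?P 2 2 - 1) + cmod (?P 3 3 - 1) + cmod (?P 2 2 - 1) * cmod (?P 3 3 - 1)
      + cmod (?P 3 2) * cmod (?P 2 3)"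
    using tri[of "?P 2 2 - 1" "?P 3 3 - 1" "(?P 2 2 - 1) * (?P 3 3 - 1)" "?P 3 2 * ?P 2 3"]
    by (simp only: norm_mult)
  also have "\<dots> \<le> ?M + ?M + ?M * ?M + ?M * ?M"
    by (intro add_mono mult_mono 22 33 23 32 norm_ge_zero) (use \<open>0 \<le> K\<close> in auto)
  finally show ?thesis by (simp add: power2_eq_square algebra_simps)
qed

text \<open>A preimage of \<open>q\<close> is a fixed point of the map sending p to p + q - \<Phi>
  p. As \<Phi> is fibered, this map preserves the slice over \<open>q $ 1\<close>, and Brouwer's
  theorem applies to a compact polydisc \<open>S\<close> in that slice.\<close>

lemma near_identity_covers:
  assumes \<Phi>: "hol_map_on \<Phi> (sectorial_domain d \<beta> r \<rho>)" and fib: "fibered_on (sectorial_domain d \<beta> r \<rho>) \<Phi>"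
    and K: "\<And>q. q \<in> sectorial_domain d \<beta> r \<rho> \<Longrightarrow> norm q \<le> 3 * R \<Longrightarrow> norm (\<Phi> q - q) \<le> K * (norm q)\<^sup>2"
    and R: "0 < R" "R < \<rho>" "18 * K * R \<le> 1" and "0 \<le> K"
    and q: "q $ 1 \<in> sector d \<beta> r" "cmod (q $ 1) \<le> R" "cmod (q $ 2) \<le> R / 2" "cmod (q $ 3) \<le> R / 2"
  obtains p where "p \<in> sectorial_domain d \<beta> r \<rho>" "\<Phi> p = q" "norm p \<le> 2 * norm q" "norm p \<le> 3 * R"
proof -
  define S where "S = {p :: complex^3. p $ 1 = q $ 1 \<and> cmod (p $ 2) \<le> R \<and> cmod (p $ 3) \<le> R}"
  have S_eq: "S = (\<lambda>p. p $ 1) -` {q $ 1} \<inter> (\<lambda>p. p $ 2) -` cball 0 R \<inter> (\<lambda>p. p $ 3) -` cball 0 R"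
    by (auto simp: S_def)
  have normS: "norm p \<le> 3 * R" if "p \<in> S" for p
    using norm_le_sum3[of p] that q by (auto simp: S_def)
  have SD: "S \<subseteq> sectorial_domain d \<beta> r \<rho>"
    using q R by (auto simp: S_def sectorial_domain_def)
  have "closed S"
    unfolding S_eq
    by (intro closed_Int closed_vimage closed_singleton closed_cball continuous_on_component continuous_on_id)
  moreover have "bounded S" using normS by (auto simp: bounded_iff)
  ultimately have "compact S" by (simp add: compact_eq_bounded_closed)
  moreover have "convex S"
    unfolding S_eq
    by (intro convex_Int convex_linear_vimage convex_singleton convex_cball
        bounded_linear.linear[OF bounded_linear_vec_nth])
  moreover have "S \<noteq> {}"
  proof -
    have "vector [q $ 1, 0, 0] \<in> S" using R by (simp add: S_def vector_3)
    then show ?thesis by blast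
  qed
  moreover have "continuous_on S (\<lambda>p. p + q - \<Phi> p)"
  proof -
    have "continuous_on S (\<lambda>p. \<Phi> p $ m)" for m
      using \<Phi> by (intro continuous_on_subset[OF hol_on_continuous SD]) (simp add: hol_map_on_def)
    then have "continuous_on S (\<lambda>p. \<chi> m. \<Phi> p $ m)" by (rule continuous_on_vec_lambda)
    then have "continuous_on S \<Phi>" by simp
    then show ?thesis by (intro continuous_intros)
  qed
  moreover have "(\<lambda>p. p + q - \<Phi> p) \<in> S \<rightarrow> S"
  proof
    fix p assume p: "p \<in> S"
    have "norm (\<Phi> p - p) \<le> K * (norm p)\<^sup>2" using K p SD normS by blast
    also have "\<dots> \<le> K * (3 * R)\<^sup>2" using normS[OF p] \<open>0 \<le> K\<close> by (intro mult_left_mono power_mono) auto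
    \<comment> \<open>The constant 18 bounds the displacement by R/2; the y coordinates of
      \<open>q\<close> contribute at most another R/2, so the map stays in \<open>S\<close>.\<close>
    also have "\<dots> = (18 * K * R) * (R / 2)" by (simp add: power2_eq_square)
    also have "\<dots> \<le> 1 * (R / 2)" using R by (intro mult_right_mono) auto
    finally have *: "norm (\<Phi> p - p) \<le> R / 2" by simp
    have "cmod (p $ m + q $ m - \<Phi> p $ m) \<le> R" if "cmod (q $ m) \<le> R / 2" for m
    proof -
      have "cmod (p $ m + q $ m - \<Phi> p $ m) = cmod (q $ m - (\<Phi> p - p) $ m)" by (simp add: algebra_simps)
      also have "\<dots> \<le> cmod (q $ m) + cmod ((\<Phi> p - p) $ m)" by (rule norm_triangle_ineq4)
      also have "\<dots> \<le> R / 2 + R / 2" using that * Finite_Cartesian_Product.norm_nth_le[of "\<Phi> p - p" m] by (intro add_mono) auto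
      finally show ?thesis by simp
    qed
    then show "p + q - \<Phi> p \<in> S"
      using p q fib SD by (auto simp: S_def fibered_on_def)
  qed
  ultimately obtain p where p: "p \<in> S" "p + q - \<Phi> p = p" using brouwer by blast
  \<comment> \<open>The displacement is at most half of \<open>norm p\<close> and is absorbed on the
    left. This linear control makes preimages tend to the origin together with their images.\<close>
  have "norm p \<le> 2 * norm q"
  proof -
    have "K * norm p \<le> K * (3 * R)" using normS[OF p(1)] \<open>0 \<le> K\<close> by (rule mult_left_mono)
    also have "\<dots> \<le> 1 / 2" using R by simp
    finally have "K * norm p * norm p \<le> 1 / 2 * norm p" by (intro mult_right_mono) auto
    moreover have "norm (\<Phi> p - p) \<le> K * (norm p)\<^sup>2" using K p SD normS by blast
    moreover have "norm p \<le> norm (\<Phi> p) + norm (\<Phi> p - p)"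
      using norm_triangle_ineq4[of "\<Phi> p" "\<Phi> p - p"] by simp
    ultimately show ?thesis using p(2) by (simp add: power2_eq_square)
  qed
  with p SD normS show ?thesis by (intro that[of p]) auto
qed

section \<open>The identity theorem, one coordinate at a time\<close>

lemma hol_on_eq_1_coord:
  fixes J :: "complex^'n \<Rightarrow> complex"
  assumes J: "hol_on J D" and S: "open S" "connected S" and D: "\<And>s. s \<in> S \<Longrightarrow> p + axis i s \<in> D"
    and U: "U \<subseteq> S" "\<xi> \<in> S" "\<xi> islimpt U" "\<And>s. s \<in> U \<Longrightarrow> J (p + axis i s) = 1" and s: "s \<in> S"
  shows "J (p + axis i s) = 1"
proof -
  have "(\<lambda>s. J (p + axis i s)) holomorphic_on S"
    unfolding holomorphic_on_def field_differentiable_def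
    by (auto intro!: exI has_field_derivative_at_within[OF hol_on_line[OF J D]])
  then have "(\<lambda>s. J (p + axis i s) - 1) holomorphic_on S" by (intro holomorphic_intros)
  from analytic_continuation[OF this S U(1-3) _ s] show ?thesis using U(4) by simp
qed

text \<open>Over each x in \<open>X\<close>, the local equality spreads through the whole polydisc,
  first in \<open>y_1\<close>, then in \<open>y_2\<close>. With y fixed, it then spreads along the
  connected sector because \<open>X\<close> accumulates inside it.\<close>

lemma sectorial_identity:
  assumes J: "hol_on J (sectorial_domain d \<beta> r \<rho>)" and d: "d \<noteq> 0" "0 < r" "\<beta> \<le> pi"
    and X: "X \<subseteq> sector d \<beta> r" "\<xi> \<in> sector d \<beta> r" "\<xi> islimpt X"
    and local: "\<And>x. x \<in> X \<Longrightarrow> \<exists>p\<in>sectorial_domain d \<beta> r \<rho>. p $ 1 = x \<and>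
       (\<exists>e>0. \<forall>q\<in>sectorial_domain d \<beta> r \<rho>. q $ 1 = x \<longrightarrow> norm (q - p) < e \<longrightarrow> J q = 1)"
    and p: "p \<in> sectorial_domain d \<beta> r \<rho>"
  shows "J p = 1"
proof -
  let ?D = "sectorial_domain d \<beta> r \<rho>"
  have slice: "J (vector [x, s, t]) = 1" if x: "x \<in> X" and st: "cmod s < \<rho>" "cmod t < \<rho>" for x s t
  proof -
    from local[OF x] obtain b e where b: "b \<in> ?D" "b $ 1 = x" "e > 0"
      "\<And>q. q \<in> ?D \<Longrightarrow> q $ 1 = x \<Longrightarrow> norm (q - b) < e \<Longrightarrow> J q = 1" by metis
    have xS: "x \<in> sector d \<beta> r" using x X by auto
    have bb: "cmod (b $ 2) < \<rho>" "cmod (b $ 3) < \<rho>" using b by (auto simp: sectorial_domain_def)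
    have 1: "J (vector [x, s, t']) = 1" if t': "cmod t' < \<rho>" "cmod (t' - b $ 3) < e / 2" for t'
    proof -
      have "J (vector [x, 0, t'] + axis 2 s) = 1"
      proof (rule hol_on_eq_1_coord[OF J, of "ball 0 \<rho>"])
        show "vector [x, 0, t'] + axis 2 s \<in> ?D" if "s \<in> ball 0 \<rho>" for s
          using that t' xS by (auto simp: sectorial_domain_def axis_def)
        show "b $ 2 islimpt (ball 0 \<rho> \<inter> ball (b $ 2) (e / 2))"
          using bb b by (intro interior_limit_point) (auto simp: interior_open)
        fix s assume s: "s \<in> ball 0 \<rho> \<inter> ball (b $ 2) (e / 2)"
        show "J (vector [x, 0, t'] + axis 2 s) = 1"
        proof (rule b(4))
          show "norm (vector [x, 0, t'] + axis 2 s - b) < e"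
            using norm_le_sum3[of "vector [x, 0, t'] + axis 2 s - b"] b(2) s t'
            by (simp add: axis_def dist_norm norm_minus_commute)
        qed (use s t' xS in \<open>auto simp: sectorial_domain_def axis_def\<close>)
      qed (use bb st in auto)
      moreover have "(vector [x, 0, t'] :: complex^3) + axis 2 s = vector [x, s, t']"
        by (simp add: vec_eq_iff forall_3 axis_def)
      ultimately show ?thesis by simp
    qed
    have "J (vector [x, s, 0] + axis 3 t) = 1"
    proof (rule hol_on_eq_1_coord[OF J, of "ball 0 \<rho>"])
      show "vector [x, s, 0] + axis 3 t \<in> ?D" if "t \<in> ball 0 \<rho>" for t
        using that st xS by (auto simp: sectorial_domain_def axis_def)
      show "b $ 3 islimpt (ball 0 \<rho> \<inter> ball (b $ 3) (e / 2))"
        using bb b by (intro interior_limit_point) (auto simp: interior_open)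
      fix t assume t: "t \<in> ball 0 \<rho> \<inter> ball (b $ 3) (e / 2)"
      have "(vector [x, s, 0] :: complex^3) + axis 3 t = vector [x, s, t]"
        by (simp add: vec_eq_iff forall_3 axis_def)
      with 1[of t] t show "J (vector [x, s, 0] + axis 3 t) = 1"
        by (simp add: dist_norm norm_minus_commute)
    qed (use bb st in auto)
    moreover have "(vector [x, s, 0] :: complex^3) + axis 3 t = vector [x, s, t]"
      by (simp add: vec_eq_iff forall_3 axis_def)
    ultimately show ?thesis by simp
  qed
  have "J (vector [0, p $ 2, p $ 3] + axis 1 (p $ 1)) = 1"
  proof (rule hol_on_eq_1_coord[OF J open_sector connected_sector])
    show "vector [0, p $ 2, p $ 3] + axis 1 x \<in> ?D" if "x \<in> sector d \<beta> r" for x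
      using that p by (auto simp: sectorial_domain_def axis_def)
    fix x assume x: "x \<in> X"
    have "(vector [0, p $ 2, p $ 3] :: complex^3) + axis 1 x = vector [x, p $ 2, p $ 3]"
      by (simp add: vec_eq_iff forall_3 axis_def)
    with slice[OF x] p show "J (vector [0, p $ 2, p $ 3] + axis 1 x) = 1"
      by (simp add: sectorial_domain_def)
  qed (use X d p in \<open>auto simp: sectorial_domain_def\<close>)
  moreover have "(vector [0, p $ 2, p $ 3] :: complex^3) + axis 1 (p $ 1) = p"
    by (simp add: vec_eq_iff forall_3 axis_def)
  ultimately show ?thesis by simp
qed


section \<open>Trajectories of the normal form tending to the origin\<close>

text \<open>As c(0) = 0, the quotient c(v)/v tends to c'(0), so the modulus of c'(0) plus 1 bounds
  it near 0.\<close>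

lemma eval_fps_linear_bound:
  fixes c :: "complex fps"
  assumes "fps_nth c 0 = 0" "0 < fps_conv_radius c"
  obtains \<eta> M where "0 < \<eta>" "0 < M" "\<And>v. cmod v \<le> \<eta> \<Longrightarrow> ereal (cmod v) < fps_conv_radius c"
    "\<And>v. cmod v \<le> \<eta> \<Longrightarrow> cmod (eval_fps c v) \<le> M * cmod v"
proof -
  have "(eval_fps c has_field_derivative eval_fps (fps_deriv c) 0) (at 0)"
    using assms(2) by (intro has_field_derivative_eval_fps) (simp add: zero_ereal_def)
  then have "((\<lambda>v. eval_fps c v / v) \<longlongrightarrow> eval_fps (fps_deriv c) 0) (at 0)"
    using assms(1) by (simp add: has_field_derivative_iff eval_fps_at_0)
  then have "((\<lambda>v. cmod (eval_fps c v / v)) \<longlongrightarrow> cmod (eval_fps (fps_deriv c) 0)) (at 0)"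
    by (rule tendsto_norm)
  then have "\<forall>\<^sub>F v in at 0. cmod (eval_fps c v / v) < cmod (eval_fps (fps_deriv c) 0) + 1"
    by (rule order_tendstoD) simp
  then obtain e where e: "e > 0"
    "\<And>v. v \<noteq> 0 \<Longrightarrow> cmod v < e \<Longrightarrow> cmod (eval_fps c v / v) < cmod (eval_fps (fps_deriv c) 0) + 1"
    by (auto simp: eventually_at)
  obtain R where R: "0 < ereal R" "ereal R < fps_conv_radius c"
    using ereal_dense2[OF assms(2)] by auto
  define \<eta> where "\<eta> = min (e / 2) R"
  show thesis
  proof
    show "0 < \<eta>" using e R by (simp add: \<eta>_def)
    show "0 < cmod (eval_fps (fps_deriv c) 0) + 1" by (simp add: add_nonneg_pos)
    fix v :: complex assume v: "cmod v \<le> \<eta>"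
    show "ereal (cmod v) < fps_conv_radius c"
      using v R(2) by (intro le_less_trans[OF _ R(2)]) (simp add: \<eta>_def)
    show "cmod (eval_fps c v) \<le> (cmod (eval_fps (fps_deriv c) 0) + 1) * cmod v"
    proof (cases "v = 0")
      case False
      then show ?thesis using e(2)[of v] v e(1) by (simp add: \<eta>_def norm_divide field_simps)
    qed (simp add: assms(1) eval_fps_at_0)
  qed
qed

text \<open>The function Re f + (ln t)/4 is nonincreasing. For the exponential of f this means decay
  like the power -1/4 of \<tau>.\<close>

lemma Re_decay:
  fixes f :: "real \<Rightarrow> complex"
  assumes "0 < T" "T \<le> \<tau>"
    and f: "\<And>t. T \<le> t \<Longrightarrow> (f has_vector_derivative f' t) (at t)"
    and f': "\<And>t. T \<le> t \<Longrightarrow> Re (f' t) \<le> - (1 / 4) / t"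
  shows "Re (f \<tau> - f T) \<le> - (ln \<tau> - ln T) / 4"
proof -
  have "Re (f \<tau>) + ln \<tau> / 4 \<le> Re (f T) + ln T / 4"
  proof (rule DERIV_nonpos_imp_nonincreasing[OF assms(2)])
    fix t assume t: "T \<le> t" "t \<le> \<tau>"
    have "((\<lambda>t. Re (f t)) has_real_derivative Re (f' t)) (at t)"
      using bounded_linear.has_vector_derivative[OF bounded_linear_Re f[OF t(1)]]
      by (simp add: has_real_derivative_iff_has_vector_derivative)
    then have "((\<lambda>t. Re (f t) + ln t / 4) has_real_derivative Re (f' t) + 1 / t / 4) (at t)"
      using DERIV_add[OF _ DERIV_cdivide[OF DERIV_ln_divide]] t assms(1) by simp
    moreover have "Re (f' t) + 1 / t / 4 \<le> 0" using f'[OF t(1)] by simp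
    ultimately show "\<exists>y. ((\<lambda>t. Re (f t) + ln t / 4) has_real_derivative y) (at t) \<and> y \<le> 0" by blast
  qed
  then show ?thesis by simp
qed

text \<open>
  Trajectories are parametrized by \<open>z = d/x\<close>, with \<open>d = \<plusminus>i\<lambda>\<close>. The logarithmic term shifts the
  exponents \<open>- Re a\<^sub>1\<close> and \<open>- Re a\<^sub>2\<close> of the growth of \<open>y\<^sub>1\<close> and \<open>y\<^sub>2\<close> in \<open>\<tau>\<close> in
  opposite directions; as their sum is \<open>-1\<close>, a suitable \<open>\<alpha>\<close> makes both equal to \<open>-1/2\<close>.
\<close>

definition zpath :: "real \<Rightarrow> real \<Rightarrow> complex" where
  "zpath \<alpha> \<tau> = Complex \<tau> (\<alpha> * ln \<tau>)"

lemma zpath_derivative: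
  assumes "0 < \<tau>"
  shows "(zpath \<alpha> has_vector_derivative Complex 1 (\<alpha> / \<tau>)) (at \<tau>)"
proof -
  have "((\<lambda>\<tau>. of_real \<tau> + \<i> * of_real (\<alpha> * ln \<tau>)) has_vector_derivative of_real 1 + \<i> * of_real (\<alpha> / \<tau>)) (at \<tau>)"
    using assms
    by (intro has_vector_derivative_add has_vector_derivative_mult_right has_vector_derivative_of_real
          DERIV_ident) (auto intro!: derivative_eq_intros)
  then show ?thesis by (simp add: zpath_def[abs_def] Complex_eq)
qed

lemma norm_zpath_ge: "\<tau> \<le> cmod (zpath \<alpha> \<tau>)"
  using complex_Re_le_cmod[of "zpath \<alpha> \<tau>"] by (simp add: zpath_def)

text \<open>This is the logarithmic derivative of a component along the path. The terms in
  \<open>u\<close> and \<open>b\<close> would give -1/2 over \<tau> if z'/z were 1/\<tau>; this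
  replacement and the perturbation \<open>g\<close> cost at most 1/8 over \<tau> each.\<close>

lemma Re_velocity_le:
  assumes \<tau>: "1 \<le> \<tau>" and b: "cmod b * \<bar>\<alpha>\<bar> * ((1 + ln \<tau>) / \<tau>) \<le> 1 / 8"
    and g: "cmod g * (1 + \<bar>\<alpha>\<bar>) \<le> 1 / 8 / \<tau>"
    and u: "Re (u * Complex 1 (\<alpha> / \<tau>)) = (Re b - 1 / 2) / \<tau>"
  shows "Re (Complex 1 (\<alpha> / \<tau>) * (u - b / zpath \<alpha> \<tau> + g)) \<le> - (1 / 4) / \<tau>"
proof -
  let ?z = "zpath \<alpha> \<tau>" and ?z' = "Complex 1 (\<alpha> / \<tau>)"
  have z: "\<tau> \<le> cmod ?z" "?z \<noteq> 0" using norm_zpath_ge[of \<tau> \<alpha>] \<tau> by auto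
  have ln: "\<bar>1 - ln \<tau>\<bar> \<le> 1 + ln \<tau>" using ln_ge_zero[OF \<tau>] by linarith
  \<comment> \<open>Since \<tau> z' - z only contains \<alpha> (1 - ln \<tau>), the difference is of
    order (ln \<tau>)/\<tau>^2.\<close>
  have "?z' / ?z - 1 / of_real \<tau> = \<i> * \<alpha> * (1 - ln \<tau>) / (?z * of_real \<tau>)"
  proof -
    have "of_real \<tau> * ?z' - ?z = \<i> * \<alpha> * (1 - ln \<tau>)"
      using \<tau> by (simp add: complex_eq_iff zpath_def algebra_simps)
    moreover have "?z' / ?z - 1 / of_real \<tau> = (?z' * of_real \<tau> - 1 * ?z) / (?z * of_real \<tau>)"
      using z \<tau> by (intro diff_frac_eq) auto
    ultimately show ?thesis by (simp add: mult.commute)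
  qed
  moreover have "b / ?z * ?z' - b / of_real \<tau> = b * (?z' / ?z - 1 / of_real \<tau>)"
    by (simp add: right_diff_distrib)
  ultimately have "b / ?z * ?z' - b / of_real \<tau> = b * (\<i> * \<alpha> * (1 - ln \<tau>) / (?z * of_real \<tau>))"
    by simp
  then have "cmod (b / ?z * ?z' - b / of_real \<tau>) = cmod b * \<bar>\<alpha>\<bar> * \<bar>1 - ln \<tau>\<bar> / (cmod ?z * \<tau>)"
    using \<tau> by (simp add: norm_mult norm_divide del: of_real_diff)
  also have "\<dots> \<le> cmod b * \<bar>\<alpha>\<bar> * (1 + ln \<tau>) / (\<tau> * \<tau>)"
    using z \<tau> ln by (intro frac_le mult_left_mono mult_right_mono) auto
  also have "\<dots> = cmod b * \<bar>\<alpha>\<bar> * ((1 + ln \<tau>) / \<tau>) / \<tau>" by simp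
  also have "\<dots> \<le> 1 / 8 / \<tau>" using b \<tau> by (intro divide_right_mono) auto
  finally have 1: "cmod (b / ?z * ?z' - b / of_real \<tau>) \<le> 1 / 8 / \<tau>" .
  have "cmod ?z' \<le> 1 + \<bar>\<alpha>\<bar> / \<tau>"
    using cmod_le[of ?z'] \<tau> by simp
  also have "\<dots> \<le> 1 + \<bar>\<alpha>\<bar>" using \<tau> by (simp add: divide_le_eq mult_le_cancel_left1)
  finally have "cmod (g * ?z') \<le> cmod g * (1 + \<bar>\<alpha>\<bar>)"
    by (simp add: norm_mult mult_left_mono)
  with g have 2: "cmod (g * ?z') \<le> 1 / 8 / \<tau>" by simp
  have "Re (?z' * (u - b / ?z + g)) = Re (u * ?z') - Re (b / of_real \<tau>) - Re (b / ?z * ?z' - b / of_real \<tau>) + Re (g * ?z')"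
    by (simp add: algebra_simps)
  also have "\<dots> \<le> (Re b - 1 / 2) / \<tau> - Re b / \<tau> + 1 / 8 / \<tau> + 1 / 8 / \<tau>"
    using 1 2 u abs_Re_le_cmod[of "b / ?z * ?z' - b / of_real \<tau>"] abs_Re_le_cmod[of "g * ?z'"]
    by (simp add: Re_divide_of_real)
  also have "\<dots> = - (1 / 4) / \<tau>" by (simp add: diff_divide_distrib)
  finally show ?thesis .
qed

text \<open>
  Along a trajectory \<open>y\<^sub>1y\<^sub>2 = k/z\<close> with \<open>k = A B z(T)\<close>. For \<open>k\<close> small and
  \<open>T\<close> large, the contribution of \<open>c\<close> and the difference between \<open>1/z\<close> and \<open>1/\<tau>\<close> change the
  exponents by at most \<open>1/8\<close> each, so that \<open>-1/2\<close> may only degrade to \<open>-1/4\<close>.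
\<close>

lemma Ynorm_trajectory:
  fixes c :: "complex fps" and lam a1 a2 d :: complex and \<sigma> \<alpha> T :: real
  assumes lam: "lam \<noteq> 0" and \<sigma>: "\<sigma> = 1 \<or> \<sigma> = - 1" and d: "d = \<i> * of_real \<sigma> * lam" and a: "a1 + a2 = 1"
    and \<alpha>: "\<alpha> = \<sigma> * (Re a1 - 1 / 2)"
    and c: "0 < \<eta>" "0 < M" "\<And>v. cmod v \<le> \<eta> \<Longrightarrow> ereal (cmod v) < fps_conv_radius c"
      "\<And>v. cmod v \<le> \<eta> \<Longrightarrow> cmod (eval_fps c v) \<le> M * cmod v"
    and T: "1 < T" "\<And>\<tau>. T \<le> \<tau> \<Longrightarrow> (cmod a1 + cmod a2) * \<bar>\<alpha>\<bar> * ((1 + ln \<tau>) / \<tau>) \<le> 1 / 8"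
    and AB: "cmod (A * B * zpath \<alpha> T) \<le> \<eta>" "M * cmod (A * B * zpath \<alpha> T) * (1 + \<bar>\<alpha>\<bar>) \<le> cmod d / 8"
  obtains q :: "real \<Rightarrow> complex^3" where "q T = vector [d / zpath \<alpha> T, A, B]"
    "\<And>\<tau>. T \<le> \<tau> \<Longrightarrow> q \<tau> $ 1 = d / zpath \<alpha> \<tau>"
    "\<And>\<tau>. T \<le> \<tau> \<Longrightarrow> cmod (q \<tau> $ 2) \<le> cmod A * exp (- (ln \<tau> - ln T) / 4)"
    "\<And>\<tau>. T \<le> \<tau> \<Longrightarrow> cmod (q \<tau> $ 3) \<le> cmod B * exp (- (ln \<tau> - ln T) / 4)"
    "\<And>\<tau> m. T \<le> \<tau> \<Longrightarrow> ((\<lambda>\<tau>. q \<tau> $ m) has_vector_derivative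
        - Complex 1 (\<alpha> / \<tau>) / d * Ynorm lam a1 a2 c (q \<tau>) $ m) (at \<tau>)"
proof -
  let ?z = "zpath \<alpha>" and ?z' = "\<lambda>\<tau>. Complex 1 (\<alpha> / \<tau>)"
  define k where "k = A * B * ?z T"
  \<comment> \<open>With the product \<open>y_1 y_2 = k/z\<close> prescribed, c becomes a function
    of z alone, and the equations for \<open>y_1\<close> and \<open>y_2\<close> decouple.\<close>
  define G where "G = (\<lambda>z. eval_fps c (k / z) / d)"
  define w where "w = lam / d"
  let ?H = "{z. Re z > 1}"
  have d0: "d \<noteq> 0" using lam \<sigma> d by auto
  have w: "w = - \<i> * of_real \<sigma>" using lam \<sigma> by (auto simp: w_def d field_simps)
  have "cmod (k / z) \<le> cmod k" if "z \<in> ?H" for z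
  proof -
    have "1 \<le> cmod z" using that complex_Re_le_cmod[of z] by simp
    then have "cmod k / cmod z \<le> cmod k / 1" by (intro divide_left_mono) auto
    then show ?thesis by (simp add: norm_divide)
  qed
  then have k: "cmod (k / z) \<le> \<eta>" if "z \<in> ?H" for z
    using AB(1) that unfolding k_def by (meson order_trans)
  have nz: "z \<noteq> 0" if "z \<in> ?H" for z using that by auto
  have "G holomorphic_on ?H"
  proof -
    have "eval_fps c holomorphic_on (\<lambda>z. k / z) ` ?H"
      using k c(3) by (intro holomorphic_on_eval_fps) (auto simp: in_eball_iff)
    moreover have "(\<lambda>z. k / z) holomorphic_on ?H" using nz by (intro holomorphic_intros)
    ultimately have "(eval_fps c \<circ> (\<lambda>z. k / z)) holomorphic_on ?H"
      by (rule holomorphic_on_compose[rotated])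
    then show ?thesis unfolding G_def o_def using d0 by (intro holomorphic_intros)
  qed
  \<comment> \<open>The half-plane is convex, so \<open>G\<close> has a primitive there; the path
    lies in it because its real part is at least T > 1.\<close>
  then obtain P where P: "\<And>z. z \<in> ?H \<Longrightarrow> (P has_field_derivative G z) (at z within ?H)"
    using holomorphic_convex_primitive'[OF convex_halfspace_Re_gt open_halfspace_Re_gt] by blast
  have P: "(P has_field_derivative G z) (at z)" if "z \<in> ?H" for z
    using P[OF that] at_within_open[OF that open_halfspace_Re_gt] by simp
  have zH: "?z \<tau> \<in> ?H" if "T \<le> \<tau>" for \<tau> using that T by (simp add: zpath_def)
  have z': "(?z has_vector_derivative ?z' \<tau>) (at \<tau>)" if "T \<le> \<tau>" for \<tau>
    using zpath_derivative that T by simp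
  \<comment> \<open>Logarithms of the solutions as functions of z: \<open>s = 1\<close>,
    \<open>b = a1\<close> for \<open>y_1\<close>, and \<open>s = -1\<close>, \<open>b = a2\<close>
    for \<open>y_2\<close>.\<close>
  define L where "L = (\<lambda>s b z. s * (w * z + P z) - b * Ln z)"
  have L: "(L s b has_field_derivative s * (w + G z) - b / z) (at z)" if "z \<in> ?H" for s b z
  proof -
    have "z \<notin> \<real>\<^sub>\<le>\<^sub>0" using that by (auto simp: complex_nonpos_Reals_iff)
    then show ?thesis
      unfolding L_def using P[OF that] by (auto intro!: derivative_eq_intros simp: field_simps)
  qed
  define f where "f = (\<lambda>s b \<tau>. L s b (?z \<tau>))"
  have f: "(f s b has_vector_derivative ?z' \<tau> * (s * (w + G (?z \<tau>)) - b / ?z \<tau>)) (at \<tau>)" if "T \<le> \<tau>" for s b \<tau>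
    using field_vector_diff_chain_at[OF z'[OF that] L[OF zH[OF that]]] by (simp add: f_def o_def)
  have Gb: "cmod (G (?z \<tau>)) * (1 + \<bar>\<alpha>\<bar>) \<le> 1 / 8 / \<tau>" if "T \<le> \<tau>" for \<tau>
  proof -
    have "cmod (G (?z \<tau>)) = cmod (eval_fps c (k / ?z \<tau>)) / cmod d" by (simp add: G_def norm_divide)
    also have "\<dots> \<le> M * cmod (k / ?z \<tau>) / cmod d" by (intro divide_right_mono c(4) k zH that) auto
    also have "M * cmod (k / ?z \<tau>) / cmod d \<le> M * (cmod k / \<tau>) / cmod d"
    proof -
      have "cmod (k / ?z \<tau>) \<le> cmod k / \<tau>"
        unfolding norm_divide using T that norm_zpath_ge[of \<tau> \<alpha>] by (intro frac_le) auto
      then show ?thesis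
        using c(2) by (intro divide_right_mono mult_left_mono) auto
    qed
    finally have "cmod (G (?z \<tau>)) * (1 + \<bar>\<alpha>\<bar>) \<le> M * (cmod k / \<tau>) / cmod d * (1 + \<bar>\<alpha>\<bar>)"
      by (rule mult_right_mono) simp
    also have "\<dots> = M * cmod k * (1 + \<bar>\<alpha>\<bar>) / (cmod d * \<tau>)" by simp
    also have "\<dots> \<le> (cmod d / 8) / (cmod d * \<tau>)"
      using AB(2) T that by (intro divide_right_mono) (auto simp: k_def)
    also have "\<dots> = 1 / 8 / \<tau>" using d0 by simp
    finally show ?thesis .
  qed
  have decay: "Re (f s b \<tau> - f s b T) \<le> - (ln \<tau> - ln T) / 4"
    if "T \<le> \<tau>" "s = 1 \<and> b = a1 \<or> s = - 1 \<and> b = a2" for s b \<tau>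
  proof (rule Re_decay[OF _ that(1) f])
    fix t assume t: "T \<le> t"
    have "Re (?z' t * (s * w - b / ?z t + s * G (?z t))) \<le> - (1 / 4) / t"
    proof (rule Re_velocity_le)
      have "0 \<le> (1 + ln t) / t" using t T by simp
      then have "cmod b * \<bar>\<alpha>\<bar> * ((1 + ln t) / t) \<le> (cmod a1 + cmod a2) * \<bar>\<alpha>\<bar> * ((1 + ln t) / t)"
        using that(2) by (intro mult_right_mono) auto
      also have "\<dots> \<le> 1 / 8" using T t by blast
      finally show "cmod b * \<bar>\<alpha>\<bar> * ((1 + ln t) / t) \<le> 1 / 8" .
      show "cmod (s * G (?z t)) * (1 + \<bar>\<alpha>\<bar>) \<le> 1 / 8 / t" using Gb[OF t] that(2) by (auto simp: norm_mult)
      \<comment> \<open>The real part of s w z' is s \<sigma> \<alpha>/\<tau>. The choice of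
        \<alpha> makes it (Re a1 - 1/2)/\<tau> for s = 1, and the relation a1 + a2 = 1 gives the
        same form with a2 for s = -1.\<close>
      have "Re a2 = 1 - Re a1" using a by (metis Re_complex_of_real add_diff_cancel_left' minus_complex.simps(1) of_real_1)
      then show "Re (s * w * ?z' t) = (Re b - 1 / 2) / t"
        using that(2) \<sigma> t T by (auto simp: w \<alpha> field_simps)
    qed (use t T in auto)
    then show "Re (?z' t * (s * (w + G (?z t)) - b / ?z t)) \<le> - (1 / 4) / t"
      by (simp add: algebra_simps)
  qed (use T in auto)
  define y where "y = (\<lambda>s b C \<tau>. C * exp (f s b \<tau> - f s b T))"
  have y': "(y s b C has_vector_derivative y s b C \<tau> * (?z' \<tau> * (s * (w + G (?z \<tau>)) - b / ?z \<tau>))) (at \<tau>)"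
    if "T \<le> \<tau>" for s b C \<tau>
  proof -
    have "((\<lambda>x. C * exp (x - f s b T)) has_field_derivative y s b C \<tau>) (at (f s b \<tau>))"
      unfolding y_def by (auto intro!: derivative_eq_intros)
    from field_vector_diff_chain_at[OF f[OF that] this]
    show ?thesis by (simp add: y_def o_def mult.commute)
  qed
  have y_bound: "cmod (y s b C \<tau>) \<le> cmod C * exp (- (ln \<tau> - ln T) / 4)"
    if "T \<le> \<tau>" "s = 1 \<and> b = a1 \<or> s = - 1 \<and> b = a2" for s b C \<tau>
    using decay[OF that] by (simp add: y_def norm_mult mult_left_mono)
  \<comment> \<open>Consistency with the definition of \<open>G\<close>: the parts with opposite
    signs s cancel, and a1 + a2 = 1 leaves exactly the factor 1/z.\<close>
  have y_prod: "y 1 a1 A \<tau> * y (- 1) a2 B \<tau> = k / ?z \<tau>" if "T \<le> \<tau>" for \<tau>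
  proof -
    have "f 1 a1 \<tau> + f (- 1) a2 \<tau> = - (a1 + a2) * Ln (?z \<tau>)" for \<tau>
      by (simp add: f_def L_def algebra_simps)
    then have "y 1 a1 A \<tau> * y (- 1) a2 B \<tau> = A * B * exp (- Ln (?z \<tau>) + Ln (?z T))"
      using a by (simp add: y_def exp_add[symmetric] algebra_simps)
    also have "\<dots> = k / ?z \<tau>"
      using nz[OF zH[OF that]] nz[OF zH[of T]] unfolding exp_add exp_minus by (simp add: k_def field_simps)
    finally show ?thesis .
  qed
  define q :: "real \<Rightarrow> complex^3" where "q = (\<lambda>\<tau>. vector [d / ?z \<tau>, y 1 a1 A \<tau>, y (- 1) a2 B \<tau>])"
  show thesis
  proof
    show "q T = vector [d / ?z T, A, B]" by (simp add: q_def y_def)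
  next
    fix \<tau> assume \<tau>: "T \<le> \<tau>"
    show "q \<tau> $ 1 = d / ?z \<tau>" by (simp add: q_def)
    show "cmod (q \<tau> $ 2) \<le> cmod A * exp (- (ln \<tau> - ln T) / 4)"
      and "cmod (q \<tau> $ 3) \<le> cmod B * exp (- (ln \<tau> - ln T) / 4)"
      using y_bound[OF \<tau>] by (simp_all add: q_def)
    \<comment> \<open>For x = d/z one has dx/dz = -x^2/d, so d/dz corresponds to the field
      multiplied by -1/d; the path supplies the factor z'.\<close>
    have 1: "((\<lambda>\<tau>. q \<tau> $ 1) has_vector_derivative - ?z' \<tau> / d * Ynorm lam a1 a2 c (q \<tau>) $ 1) (at \<tau>)"
    proof -
      have "((\<lambda>z. d / z) has_field_derivative - d / (?z \<tau>)\<^sup>2) (at (?z \<tau>))"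
        using nz[OF zH[OF \<tau>]] by (auto intro!: derivative_eq_intros simp: power2_eq_square)
      from field_vector_diff_chain_at[OF z'[OF \<tau>] this]
      show ?thesis
        using d0 by (simp add: q_def o_def Ynorm_def power2_eq_square)
    qed
    have 2: "((\<lambda>\<tau>. q \<tau> $ 2) has_vector_derivative - ?z' \<tau> / d * Ynorm lam a1 a2 c (q \<tau>) $ 2) (at \<tau>)"
    proof -
      have "- ?z' \<tau> / d * Ynorm lam a1 a2 c (q \<tau>) $ 2 = y 1 a1 A \<tau> * (?z' \<tau> * (1 * (w + G (?z \<tau>)) - a1 / ?z \<tau>))"
        using d0 by (simp add: Ynorm_def q_def y_prod[OF \<tau>] w_def G_def field_simps)
      with y'[OF \<tau>, of 1 a1 A] show ?thesis by (simp add: q_def)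
    qed
    have 3: "((\<lambda>\<tau>. q \<tau> $ 3) has_vector_derivative - ?z' \<tau> / d * Ynorm lam a1 a2 c (q \<tau>) $ 3) (at \<tau>)"
    proof -
      have "- ?z' \<tau> / d * Ynorm lam a1 a2 c (q \<tau>) $ 3 = y (- 1) a2 B \<tau> * (?z' \<tau> * (- 1 * (w + G (?z \<tau>)) - a2 / ?z \<tau>))"
        using d0 by (simp add: Ynorm_def q_def y_prod[OF \<tau>] w_def G_def field_simps)
      with y'[OF \<tau>, of "- 1" a2 B] show ?thesis by (simp add: q_def)
    qed
    show "((\<lambda>\<tau>. q \<tau> $ m) has_vector_derivative - ?z' \<tau> / d * Ynorm lam a1 a2 c (q \<tau>) $ m) (at \<tau>)" for m
      using 1 2 3 exhaust_3[of m] by auto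
  qed
qed


section \<open>Transport of the first integral along trajectories\<close>

lemma hol_on_chain:
  fixes q :: "'a::real_normed_vector \<Rightarrow> complex^'n"
  assumes f: "hol_on f E" "q \<tau> \<in> E"
    and q: "\<And>m. ((\<lambda>t. q t $ m) has_derivative Q m) (at \<tau>)"
  shows "((\<lambda>t. f (q t)) has_derivative (\<lambda>h. \<Sum>i\<in>UNIV. partial i f (q \<tau>) * Q i h)) (at \<tau>)"
proof -
  have "((\<lambda>t. \<Sum>m\<in>UNIV. axis m (q t $ m)) has_derivative (\<lambda>h. \<Sum>m\<in>UNIV. axis m (Q m h))) (at \<tau>)"
    by (intro has_derivative_sum bounded_linear.has_derivative[OF bounded_linear_axis] q)
  moreover have "(\<Sum>m\<in>UNIV. axis m (v m)) $ i = v i" for v :: "'n \<Rightarrow> complex" and i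
  proof -
    have "(\<Sum>m\<in>UNIV. axis m (v m) $ i) = (\<Sum>m\<in>UNIV. if m = i then v i else 0)"
      by (rule sum.cong) (auto simp: axis_def)
    then show ?thesis by (simp add: sum_component)
  qed
  then have "(\<Sum>m\<in>UNIV. axis m (v m)) = (\<chi> i. v i)" for v :: "'n \<Rightarrow> complex"
    by (simp add: vec_eq_iff)
  ultimately have "(q has_derivative (\<lambda>h. \<chi> m. Q m h)) (at \<tau>)" by simp
  from diff_chain_at[OF this hol_on_has_derivative[OF f]]
  show ?thesis by (simp add: o_def)
qed

text \<open>The chain rule for the inverse composed with \<Phi>, which agrees with the identity on
  the open set \<open>D\<close>.\<close>

lemma partial_inverse:
  fixes \<Phi> :: "complex^'n \<Rightarrow> complex^'n"
  assumes D: "open D" and bih: "biholomorphic_on \<Phi> D" and p: "p \<in> D"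
  shows "(\<Sum>i\<in>UNIV. partial i (\<lambda>q. inv_into D \<Phi> q $ m) (\<Phi> p) * partial k (\<lambda>q. \<Phi> q $ i) p) = (if k = m then 1 else 0)"
proof -
  let ?g = "\<lambda>q. inv_into D \<Phi> q $ m"
  have \<Phi>: "hol_on (\<lambda>q. \<Phi> q $ i) D" and g: "hol_on ?g (\<Phi> ` D)" for i
    using bih by (simp_all add: biholomorphic_on_def hol_map_on_def)
  have "((\<lambda>t. ?g (\<Phi> (p + axis k t))) has_derivative
      (\<lambda>h. \<Sum>i\<in>UNIV. partial i ?g (\<Phi> (p + axis k 0)) * (partial k (\<lambda>q. \<Phi> q $ i) p * h))) (at 0)"
    by (rule hol_on_chain[OF g])
       (use p hol_on_partial_derivative[OF \<Phi> p] in \<open>auto simp: axis_zero has_field_derivative_def\<close>)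
  then have "((\<lambda>t. ?g (\<Phi> (p + axis k t))) has_field_derivative
      (\<Sum>i\<in>UNIV. partial i ?g (\<Phi> p) * partial k (\<lambda>q. \<Phi> q $ i) p)) (at 0)"
    unfolding has_field_derivative_def
    by (rule has_derivative_eq_rhs) (simp add: fun_eq_iff axis_zero sum_distrib_right mult.assoc)
  then have "partial k (\<lambda>q. ?g (\<Phi> q)) p = (\<Sum>i\<in>UNIV. partial i ?g (\<Phi> p) * partial k (\<lambda>q. \<Phi> q $ i) p)"
    by (rule partial_eqI)
  moreover have "partial k (\<lambda>q. ?g (\<Phi> q)) p = partial k (\<lambda>q. q $ m) p"
    using bih by (intro partial_cong_open[OF D p]) (simp add: biholomorphic_on_def)
  ultimately show ?thesis by (simp add: partial_nth)
qed

text \<open>The inverse of \<Phi> carries the velocity s Z to s Y, and \<open>J\<close> has zero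
  derivative along Y. The factor \<open>s\<close> is complex because trajectories in complex time
  are followed along a real path.\<close>

lemma first_integral_along_lift:
  fixes \<Phi> Y :: "complex^3 \<Rightarrow> complex^3" and q :: "real \<Rightarrow> complex^3"
  assumes D: "open D" and bih: "biholomorphic_on \<Phi> D" and J: "hol_on J D"
    and conj: "\<forall>q\<in>\<Phi> ` D. pushforward D \<Phi> Y q = Z q"
    and q: "q \<tau> \<in> \<Phi> ` D" "\<And>m. ((\<lambda>t. q t $ m) has_vector_derivative s * Z (q \<tau>) $ m) (at \<tau>)"
    and int: "(\<Sum>k\<in>UNIV. partial k J (inv_into D \<Phi> (q \<tau>)) * Y (inv_into D \<Phi> (q \<tau>)) $ k) = 0"
  shows "((\<lambda>t. J (inv_into D \<Phi> (q t))) has_vector_derivative 0) (at \<tau>)"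
proof -
  let ?g = "inv_into D \<Phi>"
  define p where "p = ?g (q \<tau>)"
  have inj: "inj_on \<Phi> D" and g: "hol_on (\<lambda>q. ?g q $ m) (\<Phi> ` D)" for m
    using bih by (simp_all add: biholomorphic_on_def hol_map_on_def)
  have p: "p \<in> D" "\<Phi> p = q \<tau>"
    using q(1) by (auto simp: p_def inv_into_into f_inv_into_f)
  have velocity: "(\<Sum>i\<in>UNIV. partial i (\<lambda>q. ?g q $ m) (q \<tau>) * (s * Z (q \<tau>) $ i)) = s * Y p $ m" for m
  proof -
    have "(\<Sum>i\<in>UNIV. partial i (\<lambda>q. ?g q $ m) (q \<tau>) * (s * Z (q \<tau>) $ i)) =
      (\<Sum>i\<in>UNIV. \<Sum>k\<in>UNIV. s * (partial i (\<lambda>q. ?g q $ m) (\<Phi> p) * partial k (\<lambda>q. \<Phi> q $ i) p * Y p $ k))"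
      unfolding p(2)[symmetric] pushforward_conjugacy[OF inj conj p(1), symmetric]
      by (simp add: sum_distrib_left mult_ac)
    also have "\<dots> = (\<Sum>k\<in>UNIV. \<Sum>i\<in>UNIV. s * (partial i (\<lambda>q. ?g q $ m) (\<Phi> p) * partial k (\<lambda>q. \<Phi> q $ i) p * Y p $ k))"
      by (rule sum.swap)
    also have "\<dots> = (\<Sum>k\<in>UNIV. s * ((\<Sum>i\<in>UNIV. partial i (\<lambda>q. ?g q $ m) (\<Phi> p) * partial k (\<lambda>q. \<Phi> q $ i) p) * Y p $ k))"
      by (simp add: sum_distrib_left sum_distrib_right)
    also have "\<dots> = (\<Sum>k\<in>UNIV. if k = m then s * Y p $ k else 0)"
      unfolding partial_inverse[OF D bih p(1)] by (rule sum.cong) auto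
    finally show ?thesis by simp
  qed
  have "((\<lambda>t. ?g (q t) $ m) has_derivative (\<lambda>h. of_real h * (s * Y p $ m))) (at \<tau>)" for m
  proof -
    have "((\<lambda>t. ?g (q t) $ m) has_derivative (\<lambda>h. \<Sum>i\<in>UNIV. partial i (\<lambda>q. ?g q $ m) (q \<tau>) * (h *\<^sub>R (s * Z (q \<tau>) $ i)))) (at \<tau>)"
      by (rule hol_on_chain[where q = q and \<tau> = \<tau>, OF g q(1)]) (use q(2) in \<open>simp add: has_vector_derivative_def\<close>)
    moreover have "(\<Sum>i\<in>UNIV. partial i (\<lambda>q. ?g q $ m) (q \<tau>) * (h *\<^sub>R (s * Z (q \<tau>) $ i))) = of_real h * (s * Y p $ m)" for h :: real
      unfolding velocity[symmetric] by (simp add: sum_distrib_left scaleR_conv_of_real mult_ac)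
    ultimately show ?thesis by simp
  qed
  from hol_on_chain[where q = "\<lambda>t. ?g (q t)", OF J _ this]
  have "((\<lambda>t. J (?g (q t))) has_derivative (\<lambda>h. \<Sum>i\<in>UNIV. partial i J p * (of_real h * (s * Y p $ i)))) (at \<tau>)"
    using p(1) by (simp add: p_def)
  moreover have "(\<Sum>i\<in>UNIV. partial i J p * (of_real h * (s * Y p $ i))) = of_real h * s * (\<Sum>i\<in>UNIV. partial i J p * Y p $ i)" for h :: real
    by (simp add: sum_distrib_left mult_ac)
  ultimately show ?thesis
    using int by (simp add: has_vector_derivative_def p_def)
qed

section \<open>From the Jacobian to the symplectic condition, and auxiliary limits\<close>

text \<open>The component of the difference of the two forms on \<open>dy1\<close>,
  \<open>dy2\<close> is (J - 1)/x and vanishes; all other components contain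
  \<open>dx\<close>.\<close>

lemma transv_symplectic_onI:
  assumes D: "open D" "\<And>p. p \<in> D \<Longrightarrow> p $ 1 \<noteq> 0" and \<Phi>: "hol_map_on \<Phi> D" and fib: "fibered_on D \<Phi>"
    and jac: "\<And>p. p \<in> D \<Longrightarrow> yjac \<Phi> p = 1"
  shows "transv_symplectic_on D \<Phi>"
proof -
  define P where "P = (\<lambda>m q. \<Phi> q $ m)"
  \<comment> \<open>The row of \<open>dx\<close> in the pulled back form, multiplied by x;
    \<open>omega\<close> itself has no entry in this row.\<close>
  define h where "h = (\<lambda>j p. partial 1 (P 2) p * partial j (P 3) p - partial 1 (P 3) p * partial j (P 2) p)"
  define \<alpha> where "\<alpha> = (\<lambda>p. \<chi> j. h j p / p $ 1)"
  have P: "hol_on (P m) D" for m using \<Phi> by (simp add: P_def hol_map_on_def)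
  have "hol_on (h j) D" for j
    unfolding h_def by (intro hol_on_diff hol_on_mult hol_on_partial D(1) P)
  then have "mero_on (\<lambda>p. \<alpha> p $ j) D" for j
    unfolding mero_on_def by (intro exI[of _ 1] exI[of _ "h j"]) (simp add: \<alpha>_def)
  moreover have "pullback2 \<Phi> omega p - omega p = wedge dx (\<alpha> p)" if p: "p \<in> D" for p
  proof -
    have x: "\<Phi> p $ 1 = p $ 1" "p $ 1 \<noteq> 0" using fib p D(2) by (auto simp: fibered_on_def)
    have entry: "pullback2 \<Phi> omega p $ i $ j =
        (partial i (P 2) p * partial j (P 3) p - partial i (P 3) p * partial j (P 2) p) / p $ 1" for i j
      by (simp add: pullback2_def matrix_matrix_mult_def transpose_def cjacobian_def omega_def wedge_def axis_def
          sum_3 x P_def diff_divide_distrib)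
    have "partial 2 (P 2) p * partial 3 (P 3) p - partial 2 (P 3) p * partial 3 (P 2) p = 1"
      using jac[OF p] by (simp add: yjac_def P_def mult.commute)
    then have "(pullback2 \<Phi> omega p - omega p) $ i $ j = wedge dx (\<alpha> p) $ i $ j" for i j
      unfolding vector_minus_component entry
      using exhaust_3[of i] exhaust_3[of j] x(2)
      by (auto simp: wedge_def axis_def omega_def \<alpha>_def h_def field_simps)
    then show ?thesis by (simp add: vec_eq_iff)
  qed
  ultimately show ?thesis
    unfolding transv_symplectic_on_def in_ideal_dx2_def by blast
qed

lemma tangent_id_on_bound:
  assumes "tangent_id_on D \<Phi>" "0 \<notin> D"
  obtains K \<eta> where "0 < K" "0 < \<eta>" "\<And>q. q \<in> D \<Longrightarrow> norm q < \<eta> \<Longrightarrow> norm (\<Phi> q - q) \<le> K * (norm q)\<^sup>2"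
proof -
  from assms(1) obtain K where "0 < K"
    "\<forall>\<^sub>F p in at 0 within D. norm (norm (\<Phi> p - p)) \<le> K * norm (norm p ^ 2)"
    unfolding tangent_id_on_def by (rule landau_o.bigE)
  then obtain \<eta> where "0 < \<eta>" "\<forall>q\<in>D. q \<noteq> 0 \<and> dist q 0 < \<eta> \<longrightarrow> norm (\<Phi> q - q) \<le> K * (norm q)\<^sup>2"
    by (auto simp: eventually_at)
  with \<open>0 < K\<close> assms(2) show ?thesis by (intro that[of K \<eta>]) auto
qed

lemma ln_over_small:
  fixes C e :: real
  assumes "0 < e"
  obtains T where "1 < T" "\<And>t. T \<le> t \<Longrightarrow> C * ((1 + ln t) / t) \<le> e"
proof -
  have "((\<lambda>t::real. C * (inverse t + ln t / t)) \<longlongrightarrow> C * (0 + 0)) at_top"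
    by (intro tendsto_intros ln_x_over_x_tendsto_0 tendsto_inverse_0_at_top filterlim_ident)
  then have "\<forall>\<^sub>F t in at_top. C * (inverse t + ln t / t) < e"
    using assms by (intro order_tendstoD) auto
  then obtain T where T: "\<And>t. T \<le> t \<Longrightarrow> C * (inverse t + ln t / t) < e"
    by (auto simp: eventually_at_top_linorder)
  show ?thesis
  proof
    show "1 < max T 2" by simp
    show "C * ((1 + ln t) / t) \<le> e" if "max T 2 \<le> t" for t
      using T[of t] that by (simp add: add_divide_distrib inverse_eq_divide)
  qed
qed

text \<open>A connected set with more than one point has no isolated points.\<close>

lemma zpath_image_islimpt:
  assumes "d \<noteq> 0" "0 < T"
  shows "d / zpath \<alpha> T islimpt (\<lambda>t. d / zpath \<alpha> t) ` {T..}"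
proof (rule connected_imp_perfect)
  let ?X = "(\<lambda>t. d / zpath \<alpha> t) ` {T..}"
  have nz: "zpath \<alpha> t \<noteq> 0" if "0 < t" for t using norm_zpath_ge[of t \<alpha>] that by auto
  have "continuous_on {T..} (zpath \<alpha>)"
    using assms(2) by (intro continuous_at_imp_continuous_on)
      (auto intro!: has_vector_derivative_continuous zpath_derivative)
  then have "continuous_on {T..} (\<lambda>t. d / zpath \<alpha> t)"
    using nz assms by (intro continuous_intros) auto
  then show "connected ?X" by (intro connected_continuous_image) auto
  show "d / zpath \<alpha> T \<in> ?X" by (rule imageI) simp
  have "d / zpath \<alpha> T \<noteq> d / zpath \<alpha> (T + 1)"
  proof
    assume "d / zpath \<alpha> T = d / zpath \<alpha> (T + 1)"
    then have "zpath \<alpha> T = zpath \<alpha> (T + 1)" using nz[of T] nz[of "T + 1"] assms by (simp add: field_simps)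
    then show False by (simp add: zpath_def)
  qed
  moreover have "d / zpath \<alpha> T \<in> ?X" "d / zpath \<alpha> (T + 1) \<in> ?X" by (rule imageI, simp)+
  ultimately show "?X \<noteq> {x}" for x by (metis singletonD)
qed

section \<open>The transverse Jacobian is identically 1\<close>

text \<open>The sign \<sigma> treats both sectors at once: d is i lam for \<sigma> = 1 and -i lam
  for \<sigma> = -1.\<close>

lemma yjac_sectorial_normalizing_map:
  fixes U :: "(complex^3) set" and Y \<Phi> :: "complex^3 \<Rightarrow> complex^3"
    and lam a1 a2 d :: complex and c :: "complex fps" and \<sigma> \<epsilon> r \<rho> :: real
  defines "D \<equiv> sectorial_domain d (pi / 2 + \<epsilon>) r \<rho>"
  assumes saddle: "transv_hamiltonian_doubly_resonant_saddle_node lam U Y"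
    and c0: "fps_nth c 0 = 0" and a: "a1 + a2 = 1"
    and \<epsilon>: "0 < \<epsilon>" "\<epsilon> < pi / 2" and radii: "0 < r" "0 < \<rho>"
    and \<sigma>: "\<sigma> = 1 \<or> \<sigma> = - 1" and d: "d = \<i> * of_real \<sigma> * lam"
    and map: "sectorial_normalizing_map U Y lam a1 a2 c \<Phi>h d \<epsilon> r \<rho> \<Phi>"
    and p0: "p0 \<in> D"
  shows "yjac \<Phi> p0 = 1"
proof -
  have lam: "lam \<noteq> 0" and holY: "hol_map_on Y U"
    using saddle by (auto simp: transv_hamiltonian_doubly_resonant_saddle_node_def)
  obtain W where W: "open W" "0 \<in> W" "transv_hamiltonian_on W Y"
    using saddle by (auto simp: transv_hamiltonian_doubly_resonant_saddle_node_def)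
  have d0: "d \<noteq> 0" using lam \<sigma> d by auto
  have bih: "biholomorphic_on \<Phi> D" and fib: "fibered_on D \<Phi>" and tangent: "tangent_id_on D \<Phi>"
    and DU: "D \<subseteq> U"
    and conj: "\<forall>q\<in>\<Phi> ` D. ereal (cmod (q $ 2 * q $ 3)) < fps_conv_radius c \<and>
           pushforward D \<Phi> Y q = Ynorm lam a1 a2 c q"
    using map by (simp_all add: sectorial_normalizing_map_def Let_def D_def)
  have \<Phi>: "hol_map_on \<Phi> D" and inj: "inj_on \<Phi> D"
    using bih by (simp_all add: biholomorphic_on_def)
  have YD: "hol_map_on Y D" using holY DU by (auto simp: hol_map_on_def intro: hol_on_subset)
  have D: "open D" unfolding D_def using d0 \<epsilon> by (intro open_sectorial_domain) auto
  have J: "hol_on (yjac \<Phi>) D" by (rule hol_on_yjac[OF D \<Phi>])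
  have nz: "p $ 1 \<noteq> 0" if "p \<in> D" for p using that by (auto simp: D_def sectorial_domain_def sector_def)
  then have "0 \<notin> D" by fastforce
  from tangent_id_on_bound[OF tangent this] obtain K \<eta>\<^sub>0 where K: "0 < K" "0 < \<eta>\<^sub>0"
    "\<And>q. q \<in> D \<Longrightarrow> norm q < \<eta>\<^sub>0 \<Longrightarrow> norm (\<Phi> q - q) \<le> K * (norm q)\<^sup>2" by metis
  obtain \<omega> where \<omega>: "0 < \<omega>" "ball 0 \<omega> \<subseteq> W" using W by (auto simp: open_contains_ball)
  \<comment> \<open>Points of norm at most 3R must satisfy the quadratic estimate and lie in
    \<open>W\<close>; the other two bounds are those of \<open>near_identity_covers\<close>.\<close>
  define R where "R = Min {\<eta>\<^sub>0 / 4, \<omega> / 4, \<rho> / 2, 1 / (18 * K)}"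
  have R: "0 < R" "R \<le> \<eta>\<^sub>0 / 4" "R \<le> \<omega> / 4" "R \<le> \<rho> / 2" "R \<le> 1 / (18 * K)"
    using K \<omega> radii by (simp_all add: R_def)
  \<comment> \<open>The radius of convergence is positive since it strictly exceeds a modulus at the
    image of \<open>p0\<close>.\<close>
  have "ereal (cmod (\<Phi> p0 $ 2 * \<Phi> p0 $ 3)) < fps_conv_radius c" using conj p0 by blast
  then have "0 < fps_conv_radius c" by (rule le_less_trans[rotated]) simp
  from eval_fps_linear_bound[OF c0 this] obtain \<eta> M where \<eta>: "0 < \<eta>" "0 < M"
    "\<And>v. cmod v \<le> \<eta> \<Longrightarrow> ereal (cmod v) < fps_conv_radius c"
    "\<And>v. cmod v \<le> \<eta> \<Longrightarrow> cmod (eval_fps c v) \<le> M * cmod v" by metis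
  define \<alpha> where "\<alpha> = \<sigma> * (Re a1 - 1 / 2)"
  have eighth: "0 < (1 / 8 :: real)" by simp
  obtain T\<^sub>1 where T\<^sub>1: "1 < T\<^sub>1"
    "\<And>\<tau>. T\<^sub>1 \<le> \<tau> \<Longrightarrow> (cmod a1 + cmod a2) * \<bar>\<alpha>\<bar> * ((1 + ln \<tau>) / \<tau>) \<le> 1 / 8"
    using ln_over_small[OF eighth, of "(cmod a1 + cmod a2) * \<bar>\<alpha>\<bar>"] by metis
  \<comment> \<open>Beyond this time the logarithmic error is small, and x has modulus at most R and
    strictly less than r.\<close>
  define T\<^sub>0 where "T\<^sub>0 = Max {T\<^sub>1, cmod d / R, 2 * cmod d / r}"
  have T\<^sub>0: "T\<^sub>1 \<le> T\<^sub>0" "cmod d / R \<le> T\<^sub>0" "2 * cmod d / r \<le> T\<^sub>0" by (simp_all add: T\<^sub>0_def)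
  have x_small: "d / zpath \<alpha> \<tau> \<in> sector d (pi / 2 + \<epsilon>) r" "cmod (d / zpath \<alpha> \<tau>) \<le> R"
    "cmod (d / zpath \<alpha> \<tau>) \<le> cmod d / \<tau>" "zpath \<alpha> \<tau> \<noteq> 0" if "T\<^sub>0 \<le> \<tau>" for \<tau>
  proof -
    have \<tau>: "0 < \<tau>" "cmod d / R \<le> \<tau>" "2 * cmod d / r \<le> \<tau>" using that T\<^sub>0 T\<^sub>1 by linarith+
    show z: "zpath \<alpha> \<tau> \<noteq> 0" using norm_zpath_ge[of \<tau> \<alpha>] \<tau> by auto
    show le: "cmod (d / zpath \<alpha> \<tau>) \<le> cmod d / \<tau>"
      unfolding norm_divide using norm_zpath_ge[of \<tau> \<alpha>] \<tau> by (intro frac_le) auto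
    also have "\<dots> \<le> R" using \<tau> R by (simp add: field_simps)
    finally show "cmod (d / zpath \<alpha> \<tau>) \<le> R" .
    have "2 * cmod d \<le> \<tau> * r" using \<tau>(3) radii by (simp add: field_simps)
    moreover have "0 < cmod d" using d0 by simp
    ultimately have "cmod d < \<tau> * r" by linarith
    then have "cmod d / \<tau> < r" using \<tau> by (simp add: field_simps)
    with le have "cmod (d / zpath \<alpha> \<tau>) < r" by simp
    \<comment> \<open>The path has positive real part, so x/d has argument below pi/2 in modulus and
      x stays inside the sector.\<close>
    moreover have "0 < Re (inverse (zpath \<alpha> \<tau>))"
      using \<tau> by (simp add: zpath_def complex_inverse sum_power2_gt_zero_iff)
    then have "\<bar>Arg (inverse (zpath \<alpha> \<tau>))\<bar> < pi / 2" using Arg_Re_pos by blast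
    moreover have "d / zpath \<alpha> \<tau> / d = inverse (zpath \<alpha> \<tau>)" using d0 by (simp add: inverse_eq_divide)
    ultimately show "d / zpath \<alpha> \<tau> \<in> sector d (pi / 2 + \<epsilon>) r"
      using d0 z \<epsilon> by (simp add: sector_def)
  qed
  have covers: "\<exists>p\<in>D. \<Phi> p = q \<and> norm p \<le> 2 * norm q \<and> norm p \<le> 3 * R"
    if q: "q $ 1 = d / zpath \<alpha> \<tau>" "T\<^sub>0 \<le> \<tau>" "cmod (q $ 2) \<le> R / 2" "cmod (q $ 3) \<le> R / 2" for q \<tau>
  proof -
    have "18 * K * R \<le> 1" using R(5) K(1) by (simp add: field_simps)
    moreover have "norm (\<Phi> p - p) \<le> K * (norm p)\<^sup>2" if "p \<in> D" "norm p \<le> 3 * R" for p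
      using that R K by (intro K(3)) auto
    moreover have "R < \<rho>" using R radii by linarith
    moreover have "q $ 1 \<in> sector d (pi / 2 + \<epsilon>) r" "cmod (q $ 1) \<le> R"
      using x_small[OF q(2)] q(1) by auto
    ultimately obtain p where "p \<in> D" "\<Phi> p = q" "norm p \<le> 2 * norm q" "norm p \<le> 3 * R"
      using near_identity_covers[OF \<Phi>[unfolded D_def] fib[unfolded D_def], of R K q, folded D_def] K(1) R(1) q(3,4)
      by (metis less_imp_le)
    then show ?thesis by blast
  qed
  have J_near_1: "cmod (yjac \<Phi> p - 1) \<le> 8 * K * norm p + 2 * (4 * K * norm p)\<^sup>2"
    if "p \<in> D" "2 * norm p < \<eta>\<^sub>0" "2 * norm p < \<rho>" for p
    using that K by (intro yjac_near_identity[of \<Phi> d "pi / 2 + \<epsilon>" r \<rho>]) (auto simp: \<Phi> D_def[symmetric])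
  have J_eq_1: "\<exists>\<delta>>0. \<delta> \<le> R / 2 \<and> (\<forall>p\<in>D. \<Phi> p $ 1 = d / zpath \<alpha> T \<longrightarrow> cmod (\<Phi> p $ 2) \<le> \<delta> \<longrightarrow>
      cmod (\<Phi> p $ 3) \<le> \<delta> \<longrightarrow> yjac \<Phi> p = 1)" if T: "T\<^sub>0 \<le> T" for T
  proof -
    let ?z = "cmod (zpath \<alpha> T)"
    have z: "0 < ?z" using x_small(4)[OF T] by simp
    \<comment> \<open>The bound R/2 allows covering, 1 gives |AB| at most \<delta>, and the last two
      provide the smallness of A B z(T) required by \<open>Ynorm_trajectory\<close>.\<close>
    define \<delta> where "\<delta> = Min {R / 2, 1, \<eta> / ?z, cmod d / (8 * M * ?z * (1 + \<bar>\<alpha>\<bar>))}"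
    have "0 < \<delta>"
      using R z \<eta> d0 by (simp add: \<delta>_def add_pos_nonneg)
    moreover have "\<delta> \<le> R / 2" "\<delta> \<le> 1" "\<delta> \<le> \<eta> / ?z" "\<delta> \<le> cmod d / (8 * M * ?z * (1 + \<bar>\<alpha>\<bar>))"
      unfolding \<delta>_def by (rule Min_le; simp)+
    ultimately have \<delta>: "0 < \<delta>" "\<delta> \<le> R / 2" "\<delta> \<le> 1" "\<delta> \<le> \<eta> / ?z" "\<delta> \<le> cmod d / (8 * M * ?z * (1 + \<bar>\<alpha>\<bar>))"
      by blast+
    have "yjac \<Phi> p = 1" if p: "p \<in> D" "\<Phi> p $ 1 = d / zpath \<alpha> T" and AB: "cmod (\<Phi> p $ 2) \<le> \<delta>" "cmod (\<Phi> p $ 3) \<le> \<delta>" for p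
    proof -
      let ?A = "\<Phi> p $ 2" and ?B = "\<Phi> p $ 3"
      have "cmod ?A * cmod ?B * ?z \<le> \<delta> * 1 * ?z"
        using AB \<delta> by (intro mult_right_mono mult_mono) auto
      then have ABz: "cmod (?A * ?B * zpath \<alpha> T) \<le> \<delta> * ?z" by (simp add: norm_mult)
      also have "\<delta> * ?z \<le> \<eta>" using \<delta>(4) z by (simp add: field_simps)
      finally have AB1: "cmod (?A * ?B * zpath \<alpha> T) \<le> \<eta>" .
      have "M * cmod (?A * ?B * zpath \<alpha> T) * (1 + \<bar>\<alpha>\<bar>) \<le> M * (\<delta> * ?z) * (1 + \<bar>\<alpha>\<bar>)"
        using ABz \<eta> by (intro mult_right_mono mult_left_mono) auto
      also have "\<dots> \<le> cmod d / 8"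
      proof -
        have "0 < 8 * M * ?z * (1 + \<bar>\<alpha>\<bar>)" using \<eta> z by (simp add: add_pos_nonneg)
        then have "\<delta> * (8 * M * ?z * (1 + \<bar>\<alpha>\<bar>)) \<le> cmod d" using \<delta>(5) pos_le_divide_eq by blast
        then show ?thesis by (simp add: mult_ac)
      qed
      finally have AB2: "M * cmod (?A * ?B * zpath \<alpha> T) * (1 + \<bar>\<alpha>\<bar>) \<le> cmod d / 8" .
      have T1: "1 < T" "\<And>\<tau>. T \<le> \<tau> \<Longrightarrow> (cmod a1 + cmod a2) * \<bar>\<alpha>\<bar> * ((1 + ln \<tau>) / \<tau>) \<le> 1 / 8"
        using T T\<^sub>0 T\<^sub>1 by auto
      obtain q where q: "q T = vector [d / zpath \<alpha> T, ?A, ?B]"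
        "\<And>\<tau>. T \<le> \<tau> \<Longrightarrow> q \<tau> $ 1 = d / zpath \<alpha> \<tau>"
        "\<And>\<tau>. T \<le> \<tau> \<Longrightarrow> cmod (q \<tau> $ 2) \<le> cmod ?A * exp (- (ln \<tau> - ln T) / 4)"
        "\<And>\<tau>. T \<le> \<tau> \<Longrightarrow> cmod (q \<tau> $ 3) \<le> cmod ?B * exp (- (ln \<tau> - ln T) / 4)"
        "\<And>\<tau> m. T \<le> \<tau> \<Longrightarrow> ((\<lambda>\<tau>. q \<tau> $ m) has_vector_derivative
            - Complex 1 (\<alpha> / \<tau>) / d * Ynorm lam a1 a2 c (q \<tau>) $ m) (at \<tau>)"
        by (rule Ynorm_trajectory[OF lam \<sigma> d a \<alpha>_def \<eta> T1 AB1 AB2]; (assumption | (rule that; assumption)))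
      have "q T = \<Phi> p" unfolding q(1) using p(2) by (simp add: vec_eq_iff forall_3)
      define P where "P = (\<lambda>\<tau>. inv_into D \<Phi> (q \<tau>))"
      have PT: "P T = p" using inj p(1) by (simp add: P_def \<open>q T = \<Phi> p\<close>)
      \<comment> \<open>The decay bounds keep the trajectory where \<open>covers\<close> applies,
        and injectivity identifies the point found there with the lift, so its norm bounds
        transfer.\<close>
      have P: "q \<tau> \<in> \<Phi> ` D" "P \<tau> \<in> D" "norm (P \<tau>) \<le> 2 * norm (q \<tau>)" "norm (P \<tau>) \<le> 3 * R" if "T \<le> \<tau>" for \<tau>
      proof -
        have "exp (- (ln \<tau> - ln T) / 4) \<le> 1" using that T1 by simp
        then have "cmod ?A * exp (- (ln \<tau> - ln T) / 4) \<le> (R / 2) * 1" "cmod ?B * exp (- (ln \<tau> - ln T) / 4) \<le> (R / 2) * 1"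
          using AB \<delta> R by (intro mult_mono; simp)+
        then have "cmod (q \<tau> $ 2) \<le> R / 2" "cmod (q \<tau> $ 3) \<le> R / 2" using q(3,4)[OF that] by linarith+
        from covers[OF q(2)[OF that] _ this] T that obtain p' where
          p': "p' \<in> D" "\<Phi> p' = q \<tau>" "norm p' \<le> 2 * norm (q \<tau>)" "norm p' \<le> 3 * R" by auto
        moreover have "P \<tau> = p'" using inj p'(1) by (simp add: P_def p'(2)[symmetric])
        moreover show "q \<tau> \<in> \<Phi> ` D" using p'(1) unfolding p'(2)[symmetric] by (rule imageI)
        ultimately show "P \<tau> \<in> D" "norm (P \<tau>) \<le> 2 * norm (q \<tau>)" "norm (P \<tau>) \<le> 3 * R"
          by auto
      qed
      have dJ: "((\<lambda>\<tau>. yjac \<Phi> (P \<tau>)) has_vector_derivative 0) (at \<tau>)" if \<tau>: "T \<le> \<tau>" for \<tau>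
        unfolding P_def
      proof (rule first_integral_along_lift[where Z = "Ynorm lam a1 a2 c" and q = q and \<tau> = \<tau> and Y = Y, OF D bih J _ P(1)[OF \<tau>] q(5)[OF \<tau>]])
        show conj': "\<forall>q\<in>\<Phi> ` D. pushforward D \<Phi> Y q = Ynorm lam a1 a2 c q" using conj by blast
        have PW: "P \<tau> \<in> W" using P(4)[OF \<tau>] R \<omega> by (intro subsetD[OF \<omega>(2)]) simp
        \<comment> \<open>Since \<Phi> preserves x, the first component of the conjugacy determines
          that of \<open>Y\<close>; \<open>divergence_relation\<close> then gives transverse
          divergence x.\<close>
        have "Y (P \<tau>) $ 1 = (P \<tau> $ 1)\<^sup>2"
        proof -
          have "(\<Sum>k\<in>UNIV. partial k (\<lambda>q. \<Phi> q $ 1) (P \<tau>) * Y (P \<tau>) $ k) = Ynorm lam a1 a2 c (\<Phi> (P \<tau>)) $ 1"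
            by (rule pushforward_conjugacy[where Z = "Ynorm lam a1 a2 c", OF inj conj' P(2)[OF \<tau>]])
          then show ?thesis
            using fib P(2)[OF \<tau>] by (simp add: partial_fibered[OF D fib P(2)[OF \<tau>]] sum_3 Ynorm_def fibered_on_def)
        qed
        then have "partial 2 (\<lambda>q. Y q $ 2) (P \<tau>) + partial 3 (\<lambda>q. Y q $ 3) (P \<tau>) = P \<tau> $ 1"
          using divergence_relation[OF W(3,1) PW nz[OF P(2)[OF \<tau>]]] nz[OF P(2)[OF \<tau>]]
          by (simp add: power2_eq_square)
        then have "(\<Sum>k\<in>UNIV. partial k (yjac \<Phi>) (P \<tau>) * Y (P \<tau>) $ k) = 0"
          by (rule yjac_first_integral[OF D YD \<Phi> inj fib conj a P(2)[OF \<tau>]])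
        then show "(\<Sum>k\<in>UNIV. partial k (yjac \<Phi>) (inv_into D \<Phi> (q \<tau>)) * Y (inv_into D \<Phi> (q \<tau>)) $ k) = 0"
          by (simp add: P_def)
      qed
      have "((\<lambda>\<tau>. yjac \<Phi> (P \<tau>)) has_derivative (\<lambda>h. 0)) (at \<tau> within {T..})" if "\<tau> \<in> {T..}" for \<tau>
        using dJ[of \<tau>] that by (simp add: has_vector_derivative_def has_derivative_at_withinI)
      then have C: "yjac \<Phi> (P \<tau>) = yjac \<Phi> (P T)" if "T \<le> \<tau>" for \<tau>
        using that by (intro has_derivative_zero_unique[where s = "{T..}"]) auto
      have "((\<lambda>\<tau>. norm (P \<tau>)) \<longlongrightarrow> 0) at_top"
      proof (rule tendsto_sandwich[of "\<lambda>_. 0" _ _ "\<lambda>\<tau>. 2 * (cmod d / \<tau> + cmod ?A * exp (- (ln \<tau> - ln T) / 4) + cmod ?B * exp (- (ln \<tau> - ln T) / 4))"])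
        have "norm (P \<tau>) \<le> 2 * (cmod d / \<tau> + cmod ?A * exp (- (ln \<tau> - ln T) / 4) + cmod ?B * exp (- (ln \<tau> - ln T) / 4))"
          if "T \<le> \<tau>" for \<tau>
          using P(3)[OF that] norm_le_sum3[of "q \<tau>"] q(2-4)[OF that] x_small(3)[of \<tau>] T that by simp
        then show "\<forall>\<^sub>F \<tau> in at_top. norm (P \<tau>) \<le> 2 * (cmod d / \<tau> + cmod ?A * exp (- (ln \<tau> - ln T) / 4) + cmod ?B * exp (- (ln \<tau> - ln T) / 4))"
          by (rule eventually_at_top_linorderI)
        have "filterlim (\<lambda>\<tau>::real. (ln \<tau> - ln T) * (1 / 4)) at_top at_top"
          using filterlim_tendsto_add_at_top[OF tendsto_const ln_at_top, of "- ln T"]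
          by (intro filterlim_at_top_mult_tendsto_pos[OF tendsto_const]) auto
        then have "filterlim (\<lambda>\<tau>::real. - ((ln \<tau> - ln T) * (1 / 4))) at_bot at_top"
          by (subst filterlim_uminus_at_bot) (simp only: minus_minus)
        then have "filterlim (\<lambda>\<tau>::real. - (ln \<tau> - ln T) / 4) at_bot at_top"
          by (simp only: times_divide_eq_right mult_1_right minus_divide_left)
        then have e: "((\<lambda>\<tau>::real. exp (- (ln \<tau> - ln T) / 4)) \<longlongrightarrow> 0) at_top"
          by (rule filterlim_compose[OF exp_at_bot])
        have "((\<lambda>\<tau>. cmod d / \<tau>) \<longlongrightarrow> 0) at_top"
          by (intro real_tendsto_divide_at_top[OF tendsto_const] filterlim_ident)
        from tendsto_mult_left[OF tendsto_add[OF tendsto_add[OF this tendsto_mult_left[OF e]] tendsto_mult_left[OF e]], of 2 "cmod ?A" "cmod ?B"]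
        show "((\<lambda>\<tau>. 2 * (cmod d / \<tau> + cmod ?A * exp (- (ln \<tau> - ln T) / 4) + cmod ?B * exp (- (ln \<tau> - ln T) / 4))) \<longlongrightarrow> 0) at_top"
          by simp
      qed auto
      then have "((\<lambda>\<tau>. 8 * K * norm (P \<tau>) + 2 * (4 * K * norm (P \<tau>))\<^sup>2) \<longlongrightarrow> 8 * K * 0 + 2 * (4 * K * 0)\<^sup>2) at_top"
        by (intro tendsto_intros)
      \<comment> \<open>The left side does not depend on \<tau>, as the Jacobian is constant along
        the lift, while the right side tends to 0.\<close>
      moreover have "\<forall>\<^sub>F \<tau> in at_top. cmod (yjac \<Phi> p - 1) \<le> 8 * K * norm (P \<tau>) + 2 * (4 * K * norm (P \<tau>))\<^sup>2"
      proof -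
        have "\<forall>\<^sub>F \<tau> in at_top. norm (P \<tau>) < min \<eta>\<^sub>0 \<rho> / 2"
          using \<open>((\<lambda>\<tau>. norm (P \<tau>)) \<longlongrightarrow> 0) at_top\<close> K radii by (intro order_tendstoD) auto
        moreover have "\<forall>\<^sub>F \<tau> in at_top. T \<le> \<tau>" by (rule eventually_ge_at_top)
        ultimately show ?thesis
        proof eventually_elim
          case (elim \<tau>)
          then show ?case using J_near_1[OF P(2)[of \<tau>]] C[of \<tau>] PT by auto
        qed
      qed
      ultimately have "cmod (yjac \<Phi> p - 1) \<le> 8 * K * 0 + 2 * (4 * K * 0)\<^sup>2"
        by (rule tendsto_lowerbound) simp
      then show ?thesis by simp
    qed
    with \<delta> show ?thesis by blast
  qed
  let ?X = "(\<lambda>\<tau>. d / zpath \<alpha> \<tau>) ` {T\<^sub>0..}"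
  have lim: "d / zpath \<alpha> T\<^sub>0 islimpt ?X"
    using zpath_image_islimpt[OF d0, of T\<^sub>0 \<alpha>] T\<^sub>0(1) T\<^sub>1(1) by simp
  show ?thesis
  proof (rule sectorial_identity[OF J[unfolded D_def] d0 radii(1) _ _ _ lim _ p0[unfolded D_def], folded D_def])
    show "?X \<subseteq> sector d (pi / 2 + \<epsilon>) r" using x_small(1) by auto
    fix x assume "x \<in> ?X"
    then obtain T where T: "T\<^sub>0 \<le> T" "x = d / zpath \<alpha> T" by auto
    from J_eq_1[OF T(1)] obtain \<delta> where \<delta>: "\<delta> > 0" "\<delta> \<le> R / 2"
      "\<And>p. p \<in> D \<Longrightarrow> \<Phi> p $ 1 = x \<Longrightarrow> cmod (\<Phi> p $ 2) \<le> \<delta> \<Longrightarrow> cmod (\<Phi> p $ 3) \<le> \<delta> \<Longrightarrow> yjac \<Phi> p = 1"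
      unfolding T(2) by blast
    obtain p where p: "p \<in> D" "\<Phi> p = vector [x, 0, 0]"
      using covers[of "vector [x, 0, 0]" T] T R by auto
    \<comment> \<open>The preimage of the point (x, 0, 0) serves as base point for
      \<open>sectorial_identity\<close>: by continuity, nearby points have images whose y
      coordinates are at most \<delta>.\<close>
    have "p $ 1 = x" using fib p by (auto simp: fibered_on_def)
    have "continuous_on D (\<lambda>q. cmod (\<Phi> q $ 2) + cmod (\<Phi> q $ 3))"
      using \<Phi> by (intro continuous_intros hol_on_continuous) (auto simp: hol_map_on_def)
    then obtain e where e: "e > 0" "\<And>q. q \<in> D \<Longrightarrow> dist q p < e \<Longrightarrow>
       dist (cmod (\<Phi> q $ 2) + cmod (\<Phi> q $ 3)) (cmod (\<Phi> p $ 2) + cmod (\<Phi> p $ 3)) < \<delta>"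
      using p(1) \<delta>(1) unfolding continuous_on_iff by metis
    have "yjac \<Phi> q = 1" if "q \<in> D" "q $ 1 = x" "norm (q - p) < e" for q
    proof (rule \<delta>(3))
      have "cmod (\<Phi> q $ 2) + cmod (\<Phi> q $ 3) < \<delta>" using e(2)[of q] that p(2) by (simp add: dist_norm)
      then show "cmod (\<Phi> q $ 2) \<le> \<delta>" "cmod (\<Phi> q $ 3) \<le> \<delta>"
        using norm_ge_zero[of "\<Phi> q $ 2"] norm_ge_zero[of "\<Phi> q $ 3"] by linarith+
    qed (use that fib in \<open>auto simp: fibered_on_def\<close>)
    with p(1) \<open>p $ 1 = x\<close> e(1) show "\<exists>p\<in>D. p $ 1 = x \<and> (\<exists>e>0. \<forall>q\<in>D. q $ 1 = x \<longrightarrow> norm (q - p) < e \<longrightarrow> yjac \<Phi> q = 1)"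
      by blast
  qed (use x_small(1)[of T\<^sub>0] \<epsilon> in auto)
qed

theorem theorem1p19:
  fixes U :: "(complex^3) set" and Y :: "complex^3 \<Rightarrow> complex^3"
    and lam a1 a2 :: complex and c :: "complex fps" and \<Phi>h :: "fser^3"
    and \<epsilon> r \<rho> :: real and \<Phi>p \<Phi>m :: "complex^3 \<Rightarrow> complex^3"
  assumes Y: "transv_hamiltonian_doubly_resonant_saddle_node lam U Y"
    and c: "fps_nth c 0 = 0"
    and a: "a1 + a2 = 1"
    and formal: "formal_normalizing_map Y lam a1 a2 c \<Phi>h"
    and \<epsilon>: "0 < \<epsilon>" "\<epsilon> < pi / 2"
    and radii: "0 < r" "0 < \<rho>"
    and plus: "sectorial_normalizing_map U Y lam a1 a2 c \<Phi>h (\<i> * lam) \<epsilon> r \<rho> \<Phi>p"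
    and minus: "sectorial_normalizing_map U Y lam a1 a2 c \<Phi>h (- \<i> * lam) \<epsilon> r \<rho> \<Phi>m"
  shows "transv_symplectic_on (sectorial_domain (\<i> * lam) (pi / 2 + \<epsilon>) r \<rho>) \<Phi>p
       \<and> transv_symplectic_on (sectorial_domain (- \<i> * lam) (pi / 2 + \<epsilon>) r \<rho>) \<Phi>m"
proof -
  have "transv_symplectic_on (sectorial_domain d (pi / 2 + \<epsilon>) r \<rho>) \<Phi>"
    if \<sigma>: "\<sigma> = 1 \<or> \<sigma> = - 1" and d: "d = \<i> * of_real \<sigma> * lam"
      and map: "sectorial_normalizing_map U Y lam a1 a2 c \<Phi>h d \<epsilon> r \<rho> \<Phi>" for \<sigma> :: real and d \<Phi>
  proof (rule transv_symplectic_onI)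
    have "d \<noteq> 0"
      using Y \<sigma> d by (auto simp: transv_hamiltonian_doubly_resonant_saddle_node_def)
    then show "open (sectorial_domain d (pi / 2 + \<epsilon>) r \<rho>)"
      using \<epsilon> by (intro open_sectorial_domain) auto
    show "yjac \<Phi> p = 1" if "p \<in> sectorial_domain d (pi / 2 + \<epsilon>) r \<rho>" for p
      by (rule yjac_sectorial_normalizing_map[OF Y c a \<epsilon> radii \<sigma> d map that])
  qed (use map in \<open>auto simp: sectorial_normalizing_map_def Let_def biholomorphic_on_def
      sectorial_domain_def sector_def\<close>)
  from this[of 1] this[of "- 1"] plus minus show ?thesis by simp
qed

end
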